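(* Let $\Gamma$ be a totally ordered abelian group and let $\mathcal R=\mathcal R_\Gamma$ be its set of rangers provided with the ranger topology. Then: (i) The topological space $\mathcal R$ is quasi-compact, connected, and for any bounded ranger $x$ the space $\mathcal R\setminus\{x\}$ is a disjoint union of two connected components. (ii) If $x$ is a divisorial ranger, then its closure is $\overline{x}=\{x,x^+,x^-\}$ and the intervals $[-\infty,x^-]=[-\infty,x)$ and $[x^+,\infty]=(x,\infty]$ are closed. If $y$ is a ranger that is not divisorial, then the intervals $[-\infty,y)$ and $(y,\infty]$ are open; in particular, $y$ is a closed point. (iii) The maximal Hausdorff quotient $\mathcal R^h$ of $\mathcal R$ is obtained by identifying the points inside each closure $\overline{x}$ ($x$ divisorial). The induced topology on $\mathcal R^h$ is the usual order topology, and $\mathcal R^h$ is compact and connected.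
   Context: Let $\Gamma$ be a totally ordered abelian group (written additively) with divisible hull $\Gamma_{\mathbb Q}$. A ranger on $\Gamma$ is an embedding of ordered groups $\Gamma\hookrightarrow\Gamma'$ together with an element $\gamma'\in\Gamma'$; two rangers are identified if they both contain a common third one (equivalently, the ordered subgroups generated by $\Gamma$ and $\gamma'$ are isomorphic over $\Gamma$ compatibly with $\gamma'$). Equivalently, a ranger is a position relative to the ordered set $\Gamma_{\mathbb Q}$, of one of the following types: divisorial (an element of $\Gamma_{\mathbb Q}$); unbounded ($-\infty$ or $\infty$, smaller, resp. larger, than all elements of $\Gamma_{\mathbb Q}$); infinitesimal (the immediate successor $\gamma^+$ or immediate predecessor $\gamma^-$ of some $\gamma\in\Gamma_{\mathbb Q}$, i.e. $\gamma<\gamma^+<\gamma_1$ for all $\gamma_1\in\Gamma_{\mathbb Q}$ with $\gamma_1>\gamma$, and symmetrically); or cut (given by a splitting $\Gamma_{\mathbb Q}=A^-\sqcup A^+$ with $A^-<A^+$ both nonempty, $A^-$ without maximum and $A^+$ without minimum). For $\Gamma=0$ one has $0^\pm=\pm\infty$. The set $\mathcal R_\Gamma$ of all rangers is totally ordered in the obvious way; bounded rangers are those different from $\pm\infty$. The ranger topology on $\mathcal R_\Gamma$ has as base the intervals $[a,b]$ with $a,b$ divisorial or unbounded, excluding the intervals $[a,a]$ with $a$ unbounded. *)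

theory Defs
  imports "HOL-Analysis.Analysis"
begin

section \<open>The divisible hull\<close>

primrec nmult :: "nat \<Rightarrow> 'a::comm_monoid_add \<Rightarrow> 'a" where
  "nmult 0 a = 0"
| "nmult (Suc n) a = a + nmult n a"

lemma nmult_zero_right [simp]: "nmult n 0 = 0"
  by (induction n) auto

lemma nmult_one [simp]: "nmult (Suc 0) a = a"
  by simp

lemma nmult_add_right: "nmult n (a + b) = nmult n a + nmult n b"
  by (induction n) (auto simp: algebra_simps)

lemma nmult_add_left: "nmult (m + n) a = nmult m a + nmult n a"
  by (induction m) (auto simp: algebra_simps)

lemma nmult_nmult: "nmult m (nmult n a) = nmult (m * n) a"
  by (induction m) (auto simp: nmult_add_left)

lemma nmult_commute: "nmult m (nmult n a) = nmult n (nmult m a)"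
  by (simp add: nmult_nmult mult.commute)

lemma nmult_minus: "nmult n (- a) = - nmult n (a :: 'a::ab_group_add)"
  by (induction n) auto

lemma nmult_diff: "nmult n (a - b) = nmult n a - nmult n (b :: 'a::ab_group_add)"
  by (induction n) (auto simp: algebra_simps)

lemma nmult_mono: "a \<le> b \<Longrightarrow> nmult n a \<le> nmult n (b :: 'a::linordered_ab_group_add)"
  by (induction n) (auto intro: add_mono)

lemma nmult_strict_mono:
  "0 < n \<Longrightarrow> a < b \<Longrightarrow> nmult n a < nmult n (b :: 'a::linordered_ab_group_add)"
proof (induction n)
  case (Suc n)
  then show ?case
    by (cases n) (auto intro: add_strict_mono)
qed simp

lemma nmult_less_iff:
  "0 < n \<Longrightarrow> nmult n a < nmult n b \<longleftrightarrow> a < (b :: 'a::linordered_ab_group_add)"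
  by (meson linorder_not_less nmult_mono nmult_strict_mono)

lemma nmult_le_iff:
  "0 < n \<Longrightarrow> nmult n a \<le> nmult n b \<longleftrightarrow> a \<le> (b :: 'a::linordered_ab_group_add)"
  by (meson linorder_not_less nmult_less_iff)

lemma nmult_eq_iff:
  "0 < n \<Longrightarrow> nmult n a = nmult n b \<longleftrightarrow> a = (b :: 'a::linordered_ab_group_add)"
  using nmult_le_iff[of n a b] nmult_le_iff[of n b a] by auto

text \<open>The pair \<open>(a, m)\<close> with \<open>m \<noteq> 0\<close> stands for the fraction \<open>a / m\<close>; cross-multiplication
  suffices for equality of fractions because an ordered group is torsion-free.\<close>

definition hull_rel :: "'a::linordered_ab_group_add \<times> nat \<Rightarrow> 'a \<times> nat \<Rightarrow> bool" where
  "hull_rel x y \<longleftrightarrow> snd x \<noteq> 0 \<and> snd y \<noteq> 0 \<and> nmult (snd y) (fst x) = nmult (snd x) (fst y)"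

lemma part_equivp_hull_rel: "part_equivp (hull_rel :: 'a::linordered_ab_group_add \<times> nat \<Rightarrow> _)"
proof (rule part_equivpI)
  show "\<exists>x :: 'a \<times> nat. hull_rel x x"
    by (rule exI[of _ "(0, 1)"]) (simp add: hull_rel_def)
  show "symp (hull_rel :: 'a \<times> nat \<Rightarrow> _)"
    by (auto simp: symp_def hull_rel_def)
  show "transp (hull_rel :: 'a \<times> nat \<Rightarrow> _)"
  proof (rule transpI, unfold split_paired_all)
    fix a b c :: 'a and k m n :: nat
    assume 1: "hull_rel (a, k) (b, m)" and 2: "hull_rel (b, m) (c, n)"
    have "nmult m (nmult n a) = nmult n (nmult m a)" by (rule nmult_commute)
    also have "\<dots> = nmult n (nmult k b)" using 1 by (simp add: hull_rel_def)
    also have "\<dots> = nmult k (nmult n b)" by (rule nmult_commute)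
    also have "\<dots> = nmult k (nmult m c)" using 2 by (simp add: hull_rel_def)
    also have "\<dots> = nmult m (nmult k c)" by (rule nmult_commute)
    finally show "hull_rel (a, k) (c, n)"
      using 1 2 by (simp add: hull_rel_def nmult_eq_iff)
  qed
qed

quotient_type (overloaded) 'a divisible_hull = "'a::linordered_ab_group_add \<times> nat" / partial: hull_rel
  by (rule part_equivp_hull_rel)

lift_definition frac :: "'a::linordered_ab_group_add \<Rightarrow> nat \<Rightarrow> 'a divisible_hull" is
  "\<lambda>a m. if m = 0 then (0, 1) else (a, m)"
  by (simp add: hull_rel_def)

instantiation divisible_hull :: (linordered_ab_group_add) linordered_ab_group_add
begin

lift_definition zero_divisible_hull :: "'a divisible_hull" is "(0, 1)"
  by (simp add: hull_rel_def)

lift_definition plus_divisible_hull ::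
  "'a divisible_hull \<Rightarrow> 'a divisible_hull \<Rightarrow> 'a divisible_hull" is
  "\<lambda>(a, m) (b, n). (nmult n a + nmult m b, m * n)"
proof (clarsimp simp: hull_rel_def nmult_add_right nmult_nmult)
  fix a b c d :: 'a and k l m n :: nat
  assume 1: "nmult l a = nmult k b" and 2: "nmult n c = nmult m d"
  have "nmult (l * n * m) a = nmult (m * n) (nmult l a)" by (simp add: nmult_nmult ac_simps)
  also have "\<dots> = nmult (k * m * n) b" by (simp add: nmult_nmult 1 ac_simps)
  finally have A: "nmult (l * n * m) a = nmult (k * m * n) b" .
  have "nmult (l * n * k) c = nmult (k * l) (nmult n c)" by (simp add: nmult_nmult ac_simps)
  also have "\<dots> = nmult (k * m * l) d" by (simp add: nmult_nmult 2 ac_simps)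
  finally show "nmult (l * n * m) a + nmult (l * n * k) c
      = nmult (k * m * n) b + nmult (k * m * l) d"
    using A by simp
qed

lift_definition uminus_divisible_hull :: "'a divisible_hull \<Rightarrow> 'a divisible_hull" is
  "\<lambda>(a, m). (- a, m)"
  by (auto simp: hull_rel_def nmult_minus)

definition minus_divisible_hull :: "'a divisible_hull \<Rightarrow> 'a divisible_hull \<Rightarrow> 'a divisible_hull" where
  "minus_divisible_hull p q = p + - q"

lift_definition less_eq_divisible_hull :: "'a divisible_hull \<Rightarrow> 'a divisible_hull \<Rightarrow> bool" is
  "\<lambda>(a, m) (b, n). nmult n a \<le> nmult m b"
proof (clarsimp simp: hull_rel_def)
  fix a b c d :: 'a and k l m n :: nat
  assume pos: "0 < k" "0 < l" "0 < m" "0 < n"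
    and 1: "nmult l a = nmult k b" and 2: "nmult n c = nmult m d"
  have "nmult m a \<le> nmult k c \<longleftrightarrow> nmult (l * n) (nmult m a) \<le> nmult (l * n) (nmult k c)"
    using pos by (simp add: nmult_le_iff)
  also have "nmult (l * n) (nmult m a) = nmult (n * m) (nmult l a)"
    by (simp add: nmult_nmult ac_simps)
  also have "\<dots> = nmult (k * m) (nmult n b)"
    unfolding 1 by (simp add: nmult_nmult ac_simps)
  also have "nmult (l * n) (nmult k c) = nmult (l * k) (nmult n c)"
    by (simp add: nmult_nmult ac_simps)
  also have "\<dots> = nmult (k * m) (nmult l d)"
    unfolding 2 by (simp add: nmult_nmult ac_simps)
  also have "nmult (k * m) (nmult n b) \<le> nmult (k * m) (nmult l d) \<longleftrightarrow> nmult n b \<le> nmult l d"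
    using pos by (simp add: nmult_le_iff)
  finally show "nmult m a \<le> nmult k c \<longleftrightarrow> nmult n b \<le> nmult l d" .
qed

definition less_divisible_hull :: "'a divisible_hull \<Rightarrow> 'a divisible_hull \<Rightarrow> bool" where
  "less_divisible_hull p q \<longleftrightarrow> p \<le> q \<and> \<not> q \<le> p"

lemma hull_le_trans_aux:
  fixes a b c :: 'a
  assumes "0 < k" "0 < m" "0 < n" "nmult m a \<le> nmult k b" "nmult n b \<le> nmult m c"
  shows "nmult n a \<le> nmult k c"
proof -
  have "nmult m (nmult n a) = nmult n (nmult m a)" by (rule nmult_commute)
  also have "\<dots> \<le> nmult n (nmult k b)" using assms by (simp add: nmult_mono)
  also have "\<dots> = nmult k (nmult n b)" by (rule nmult_commute)
  also have "\<dots> \<le> nmult k (nmult m c)" using assms by (simp add: nmult_mono)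
  also have "\<dots> = nmult m (nmult k c)" by (rule nmult_commute)
  finally show ?thesis using assms by (simp add: nmult_le_iff)
qed

instance
proof
  fix p q r :: "'a divisible_hull"
  show "p + q + r = p + (q + r)"
    by transfer (auto simp: hull_rel_def nmult_add_right nmult_nmult ac_simps)
  show "p + q = q + p"
    by transfer (auto simp: hull_rel_def nmult_add_right nmult_nmult ac_simps)
  show "0 + p = p"
    by transfer (auto simp: hull_rel_def)
  show "- p + p = 0"
    by transfer (auto simp: hull_rel_def nmult_minus)
  show "p - q = p + - q"
    by (rule minus_divisible_hull_def)
  show "p < q \<longleftrightarrow> p \<le> q \<and> \<not> q \<le> p"
    by (rule less_divisible_hull_def)
  show "p \<le> p"
    by transfer auto
  show "p \<le> q \<or> q \<le> p"
    by transfer auto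
  show "p \<le> q \<Longrightarrow> q \<le> p \<Longrightarrow> p = q"
    by transfer (auto simp: hull_rel_def)
  show "p \<le> q \<Longrightarrow> q \<le> r \<Longrightarrow> p \<le> r"
    by transfer (auto simp: hull_rel_def intro: hull_le_trans_aux)
  show "r + p \<le> r + q" if "p \<le> q"
    using that
  proof (transfer, clarsimp simp: hull_rel_def)
    fix a b c :: 'a and k m n :: nat
    assume "0 < n" "0 < k" "0 < m" and le: "nmult m a \<le> nmult k b"
    have "nmult (n * n) (nmult m a) \<le> nmult (n * n) (nmult k b)"
      using le by (rule nmult_mono)
    then show "nmult (n * m) (nmult k c + nmult n a) \<le> nmult (n * k) (nmult m c + nmult n b)"
      by (simp add: nmult_add_right nmult_nmult ac_simps)
  qed
qed

end

lemma frac_cases: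
  obtains a n where "q = frac a n" "0 < n"
proof -
  have "\<exists>a n. 0 < n \<and> q = frac a n"
    by transfer (auto simp: hull_rel_def split: prod.splits)
  then show ?thesis using that by blast
qed

lemma frac_le_frac_iff: "0 < m \<Longrightarrow> 0 < n \<Longrightarrow> frac a m \<le> frac b n \<longleftrightarrow> nmult n a \<le> nmult m b"
  by transfer simp

lemma frac_less_frac_iff: "0 < m \<Longrightarrow> 0 < n \<Longrightarrow> frac a m < frac b n \<longleftrightarrow> nmult n a < nmult m b"
  by (metis frac_le_frac_iff linorder_not_le)

lemma frac_eq_frac_iff: "0 < m \<Longrightarrow> 0 < n \<Longrightarrow> frac a m = frac b n \<longleftrightarrow> nmult n a = nmult m b"
  by transfer (simp add: hull_rel_def)

lemma frac_add_one: "frac (a + b) 1 = frac a 1 + frac b 1"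
  by transfer (simp add: hull_rel_def)

lemma frac_zero: "0 < n \<Longrightarrow> frac 0 n = 0"
  by transfer (simp add: hull_rel_def)

lemma nmult_frac: "0 < n \<Longrightarrow> nmult k (frac a n) = frac (nmult k a) n"
proof (induction k)
  case 0
  then show ?case by (simp add: frac_zero)
next
  case (Suc k)
  have "frac a n + frac (nmult k a) n = frac (a + nmult k a) n"
    using Suc.prems by transfer (simp add: hull_rel_def nmult_add_right nmult_nmult ac_simps)
  with Suc show ?case by simp
qed

lemma nmult_hull_exists:
  fixes q :: "'a::linordered_ab_group_add divisible_hull"
  shows "\<exists>n a. 0 < n \<and> nmult n q = frac a 1"
proof -
  obtain a n where q: "q = frac a n" "0 < n" by (rule frac_cases)
  then have "nmult n q = frac a 1"
    by (simp add: nmult_frac frac_eq_frac_iff)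
  with q show ?thesis by blast
qed

lemma hull_divisible:
  fixes q :: "'a::linordered_ab_group_add divisible_hull"
  assumes "0 < n"
  shows "\<exists>p. nmult n p = q"
proof -
  obtain a m where q: "q = frac a m" "0 < m" by (rule frac_cases)
  then have "nmult n (frac a (n * m)) = q"
    using assms by (simp add: nmult_frac frac_eq_frac_iff nmult_nmult ac_simps)
  then show ?thesis by blast
qed


section \<open>Rangers\<close>

text \<open>A position relative to the divisible hull is recorded by the set of hull elements below it
  and the set of hull elements above it; at most one hull element is in neither of the two.\<close>

definition is_position :: "'q::linorder set \<times> 'q set \<Rightarrow> bool" where
  "is_position p \<longleftrightarrow>
     (\<forall>a\<in>fst p. \<forall>b\<le>a. b \<in> fst p) \<and>
     (\<forall>a\<in>snd p. \<forall>b\<ge>a. b \<in> snd p) \<and>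
     fst p \<inter> snd p = {} \<and>
     (\<forall>a b. a \<notin> fst p \<union> snd p \<longrightarrow> b \<notin> fst p \<union> snd p \<longrightarrow> a = b)"

typedef (overloaded) 'a ranger =
  "{p :: 'a::linordered_ab_group_add divisible_hull set \<times> 'a divisible_hull set. is_position p}"
  by (rule exI[of _ "({}, UNIV)"]) (simp add: is_position_def)

definition hull_below :: "'a::linordered_ab_group_add ranger \<Rightarrow> 'a divisible_hull set" where
  "hull_below x = fst (Rep_ranger x)"

definition hull_above :: "'a::linordered_ab_group_add ranger \<Rightarrow> 'a divisible_hull set" where
  "hull_above x = snd (Rep_ranger x)"

lemma ranger_eq_iff: "x = y \<longleftrightarrow> hull_below x = hull_below y \<and> hull_above x = hull_above y"
  unfolding hull_below_def hull_above_def by (metis Rep_ranger_inject prod_eqI)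

lemma is_position_below_above: "is_position (hull_below x, hull_above x)"
  using Rep_ranger[of x] by (simp add: hull_below_def hull_above_def)

lemma below_Abs_ranger: "is_position p \<Longrightarrow> hull_below (Abs_ranger p) = fst p"
  and above_Abs_ranger: "is_position p \<Longrightarrow> hull_above (Abs_ranger p) = snd p"
  by (simp_all add: hull_below_def hull_above_def Abs_ranger_inverse)

lemma below_downward: "a \<in> hull_below x \<Longrightarrow> b \<le> a \<Longrightarrow> b \<in> hull_below x"
  using is_position_below_above[of x] by (auto simp: is_position_def)

lemma above_upward: "a \<in> hull_above x \<Longrightarrow> a \<le> b \<Longrightarrow> b \<in> hull_above x"
  using is_position_below_above[of x] by (auto simp: is_position_def)

lemma below_above_disjoint: "a \<in> hull_below x \<Longrightarrow> a \<notin> hull_above x"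
  using is_position_below_above[of x] by (auto simp: is_position_def)

lemma below_above_missing: "a \<notin> hull_below x \<Longrightarrow> a \<notin> hull_above x \<Longrightarrow> b \<notin> hull_below x \<Longrightarrow> b \<notin> hull_above x \<Longrightarrow> a = b"
  using is_position_below_above[of x] by (auto simp: is_position_def)

instantiation ranger :: (linordered_ab_group_add) linorder
begin

definition less_eq_ranger :: "'a ranger \<Rightarrow> 'a ranger \<Rightarrow> bool" where
  "x \<le> y \<longleftrightarrow> hull_below x \<subseteq> hull_below y \<and> hull_above y \<subseteq> hull_above x"

definition less_ranger :: "'a ranger \<Rightarrow> 'a ranger \<Rightarrow> bool" where
  "x < y \<longleftrightarrow> x \<le> y \<and> \<not> y \<le> (x :: 'a ranger)"

lemma ranger_le_of_witness:
  fixes x y :: "'a ranger"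
  assumes q: "q \<notin> hull_below x" "q \<notin> hull_above y" "q \<in> hull_below y \<or> q \<in> hull_above x"
  shows "x \<le> y"
  unfolding less_eq_ranger_def
proof (intro conjI subsetI)
  fix a assume a: "a \<in> hull_below x"
  have "a < q" using a q(1) below_downward by (meson linorder_not_less)
  show "a \<in> hull_below y"
  proof (rule ccontr)
    assume n: "a \<notin> hull_below y"
    have "q \<notin> hull_below y" using n \<open>a < q\<close> below_downward less_imp_le by blast
    have "a \<in> hull_above y" using below_above_missing[of a y q] n q \<open>q \<notin> hull_below y\<close> \<open>a < q\<close> by auto
    then show False using q(2) \<open>a < q\<close> above_upward less_imp_le by blast
  qed
next
  fix a assume a: "a \<in> hull_above y"
  have "q < a" using a q(2) above_upward by (meson linorder_not_less)
  show "a \<in> hull_above x"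
  proof (rule ccontr)
    assume n: "a \<notin> hull_above x"
    have "q \<notin> hull_above x" using n \<open>q < a\<close> above_upward less_imp_le by blast
    have "a \<in> hull_below x" using below_above_missing[of a x q] n q \<open>q \<notin> hull_above x\<close> \<open>q < a\<close> by auto
    then show False using q(1) \<open>q < a\<close> below_downward less_imp_le by blast
  qed
qed

instance
proof
  fix x y z :: "'a ranger"
  show "x < y \<longleftrightarrow> x \<le> y \<and> \<not> y \<le> x" by (rule less_ranger_def)
  show "x \<le> x" by (simp add: less_eq_ranger_def)
  show "x \<le> y \<Longrightarrow> y \<le> z \<Longrightarrow> x \<le> z" by (auto simp: less_eq_ranger_def)
  show "x \<le> y \<Longrightarrow> y \<le> x \<Longrightarrow> x = y" by (auto simp: less_eq_ranger_def ranger_eq_iff)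
  show "x \<le> y \<or> y \<le> x"
  proof (cases "x \<le> y")
    case False
    then consider q where "q \<in> hull_below x" "q \<notin> hull_below y" | q where "q \<in> hull_above y" "q \<notin> hull_above x"
      by (auto simp: less_eq_ranger_def)
    then have "y \<le> x"
      by cases (metis ranger_le_of_witness below_above_disjoint)+
    then show ?thesis ..
  qed simp
qed

end

lemma is_position_intervals:
  fixes q :: "'q::linorder"
  shows "is_position ({..<q}, {q<..})" "is_position ({..q}, {q<..})" "is_position ({..<q}, {q..})"
    "is_position ({} :: 'q set, UNIV)" "is_position (UNIV :: 'q set, {})"
  by (auto simp: is_position_def)

definition divisorial :: "'a::linordered_ab_group_add divisible_hull \<Rightarrow> 'a ranger" where
  "divisorial q = Abs_ranger ({..<q}, {q<..})"

text \<open>For the trivial group the two infinitesimal rangers coincide with the unbounded ones.\<close>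

definition succ_ranger :: "'a::linordered_ab_group_add divisible_hull \<Rightarrow> 'a ranger" where
  "succ_ranger q = Abs_ranger ({..q}, {q<..})"

definition pred_ranger :: "'a::linordered_ab_group_add divisible_hull \<Rightarrow> 'a ranger" where
  "pred_ranger q = Abs_ranger ({..<q}, {q..})"

definition minus_infinity :: "'a::linordered_ab_group_add ranger" where
  "minus_infinity = Abs_ranger ({}, UNIV)"

definition plus_infinity :: "'a::linordered_ab_group_add ranger" where
  "plus_infinity = Abs_ranger (UNIV, {})"

definition is_divisorial :: "'a::linordered_ab_group_add ranger \<Rightarrow> bool" where
  "is_divisorial x \<longleftrightarrow> x \<in> range divisorial"

definition is_unbounded :: "'a::linordered_ab_group_add ranger \<Rightarrow> bool" where
  "is_unbounded x \<longleftrightarrow> x = minus_infinity \<or> x = plus_infinity"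

definition is_infinitesimal :: "'a::linordered_ab_group_add ranger \<Rightarrow> bool" where
  "is_infinitesimal x \<longleftrightarrow> x \<in> range succ_ranger \<union> range pred_ranger"

definition is_cut :: "'a::linordered_ab_group_add ranger \<Rightarrow> bool" where
  "is_cut x \<longleftrightarrow> hull_below x \<union> hull_above x = UNIV \<and> hull_below x \<noteq> {} \<and> hull_above x \<noteq> {} \<and>
     (\<forall>a\<in>hull_below x. \<exists>b\<in>hull_below x. a < b) \<and> (\<forall>a\<in>hull_above x. \<exists>b\<in>hull_above x. b < a)"

lemma below_simps [simp]:
  "hull_below (divisorial q) = {..<q}" "hull_below (succ_ranger q) = {..q}" "hull_below (pred_ranger q) = {..<q}"
  "hull_below minus_infinity = {}" "hull_below plus_infinity = UNIV"
  by (simp_all add: divisorial_def succ_ranger_def pred_ranger_def minus_infinity_def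
      plus_infinity_def below_Abs_ranger is_position_intervals)

lemma above_simps [simp]:
  "hull_above (divisorial q) = {q<..}" "hull_above (succ_ranger q) = {q<..}" "hull_above (pred_ranger q) = {q..}"
  "hull_above minus_infinity = UNIV" "hull_above plus_infinity = {}"
  by (simp_all add: divisorial_def succ_ranger_def pred_ranger_def minus_infinity_def
      plus_infinity_def above_Abs_ranger is_position_intervals)

lemma divisorial_of_missing:
  assumes q: "q \<notin> hull_below x" "q \<notin> hull_above x"
  shows "x = divisorial q"
proof -
  have "hull_below x = {..<q}"
  proof (intro equalityI subsetI)
    fix a assume "a \<in> hull_below x"
    then show "a \<in> {..<q}" using q below_downward by (metis lessThan_iff linorder_not_less)
  next
    fix a assume a: "a \<in> {..<q}"
    then show "a \<in> hull_below x"
      using q above_upward[of a x q] below_above_missing[of a x q]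
      by (metis lessThan_iff less_irrefl less_imp_le)
  qed
  moreover have "hull_above x = {q<..}"
  proof (intro equalityI subsetI)
    fix a assume "a \<in> hull_above x"
    then show "a \<in> {q<..}" using q above_upward by (metis greaterThan_iff linorder_not_less)
  next
    fix a assume a: "a \<in> {q<..}"
    then show "a \<in> hull_above x"
      using q below_downward[of a x q] below_above_missing[of a x q]
      by (metis greaterThan_iff less_irrefl less_imp_le)
  qed
  ultimately show ?thesis by (simp add: ranger_eq_iff)
qed

lemma ranger_types: "is_divisorial x \<or> is_unbounded x \<or> is_infinitesimal x \<or> is_cut x"
proof (cases "hull_below x \<union> hull_above x = UNIV")
  case False
  then obtain q where "q \<notin> hull_below x" "q \<notin> hull_above x" by auto
  then have "x = divisorial q" by (rule divisorial_of_missing)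
  then show ?thesis by (simp add: is_divisorial_def)
next
  case True
  then have compl: "hull_above x = - hull_below x" using below_above_disjoint by blast
  show ?thesis
  proof (rule ccontr)
    assume n: "\<not> ?thesis"
    then have "hull_below x \<noteq> {}" "hull_above x \<noteq> {}"
      using compl by (auto simp: is_unbounded_def ranger_eq_iff)
    then consider a where "a \<in> hull_below x" "\<forall>b\<in>hull_below x. b \<le> a"
      | a where "a \<in> hull_above x" "\<forall>b\<in>hull_above x. a \<le> b"
      using n True by (auto simp: is_cut_def linorder_not_less)
    then show False
    proof cases
      case 1
      then have "hull_below x = {..a}" using below_downward by blast
      then have "x = succ_ranger a" using compl by (auto simp: ranger_eq_iff)
      then show False using n by (simp add: is_infinitesimal_def)
    next
      case 2
      then have "hull_above x = {a..}" using above_upward by blast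
      then have "hull_below x = {..<a}" using compl
        by (metis Compl_atLeast double_complement)
      then have "x = pred_ranger a" using \<open>hull_above x = {a..}\<close> by (auto simp: ranger_eq_iff)
      then show False using n by (simp add: is_infinitesimal_def)
    qed
  qed
qed

lemma divisorial_le_iff: "divisorial a \<le> divisorial b \<longleftrightarrow> a \<le> b"
proof
  assume "divisorial a \<le> divisorial b"
  then have "{..<a} \<subseteq> {..<b}" by (simp add: less_eq_ranger_def)
  then show "a \<le> b" by (meson lessThan_iff less_irrefl linorder_not_le subsetD)
qed (auto simp: less_eq_ranger_def)

lemma divisorial_less_iff: "divisorial a < divisorial b \<longleftrightarrow> a < b"
  by (metis divisorial_le_iff linorder_not_le)

lemma mem_below_iff: "q \<in> hull_below x \<longleftrightarrow> divisorial q < x"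
proof
  assume "q \<in> hull_below x"
  then have "\<not> x \<le> divisorial q" by (auto simp: less_eq_ranger_def)
  then show "divisorial q < x" by simp
next
  assume less: "divisorial q < x"
  show "q \<in> hull_below x"
  proof (rule ccontr)
    assume "q \<notin> hull_below x"
    moreover have "q \<notin> hull_above x"
      using less_imp_le[OF less] by (auto simp: less_eq_ranger_def)
    ultimately have "x = divisorial q" by (rule divisorial_of_missing)
    then show False using less by simp
  qed
qed

lemma mem_above_iff: "q \<in> hull_above x \<longleftrightarrow> x < divisorial q"
proof
  assume "q \<in> hull_above x"
  then have "\<not> divisorial q \<le> x" by (auto simp: less_eq_ranger_def)
  then show "x < divisorial q" by simp
next
  assume less: "x < divisorial q"
  show "q \<in> hull_above x"
  proof (rule ccontr)
    assume q: "q \<notin> hull_above x"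
    have "q \<notin> hull_below x"
      using less_imp_le[OF less] by (auto simp: less_eq_ranger_def)
    then have "x = divisorial q" using q by (rule divisorial_of_missing)
    then show False using less by simp
  qed
qed

lemma minus_infinity_le [simp]: "minus_infinity \<le> x"
  by (simp add: less_eq_ranger_def)

lemma le_plus_infinity [simp]: "x \<le> plus_infinity"
  by (simp add: less_eq_ranger_def)

lemma pred_ranger_less: "pred_ranger q < divisorial q"
  and less_succ_ranger: "divisorial q < succ_ranger q"
  by (simp_all flip: mem_above_iff mem_below_iff)

lemma not_between_succ_ranger: "\<not> (divisorial q < x \<and> x < succ_ranger q)"
proof
  assume *: "divisorial q < x \<and> x < succ_ranger q"
  then have "q \<in> hull_below x" by (simp add: mem_below_iff)
  then have "{..q} \<subseteq> hull_below x" using below_downward by blast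
  moreover have "hull_above x \<subseteq> {q<..}"
    using * less_imp_le[of "divisorial q" x] by (simp add: less_eq_ranger_def)
  ultimately have "succ_ranger q \<le> x" by (simp add: less_eq_ranger_def)
  then show False using * leD by blast
qed


subsection \<open>Rangers and embeddings of ordered groups\<close>

definition ordered_group_embedding ::
  "('a::linordered_ab_group_add \<Rightarrow> 'b::linordered_ab_group_add) \<Rightarrow> bool" where
  "ordered_group_embedding f \<longleftrightarrow> (\<forall>a b. f (a + b) = f a + f b) \<and> strict_mono f"

definition ranger_of ::
  "('a::linordered_ab_group_add \<Rightarrow> 'b::linordered_ab_group_add) \<Rightarrow> 'b \<Rightarrow> 'a ranger" where
  "ranger_of f c = Abs_ranger
     ({frac a n |a n. 0 < n \<and> f a < nmult n c}, {frac a n |a n. 0 < n \<and> nmult n c < f a})"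

definition group_adjoin ::
  "('a::linordered_ab_group_add \<Rightarrow> 'b::linordered_ab_group_add) \<Rightarrow> 'b \<Rightarrow> 'b set" where
  "group_adjoin f c = {f a + nmult m c - nmult n c |a m n. True}"

lemma embedding_nmult: "ordered_group_embedding f \<Longrightarrow> f (nmult n a) = nmult n (f a)"
proof (induction n)
  case 0
  then have "f (0 + 0) = f 0 + f 0" unfolding ordered_group_embedding_def by blast
  then show ?case by simp
qed (simp add: ordered_group_embedding_def)

lemma embedding_less_iff: "ordered_group_embedding f \<Longrightarrow> f a < f b \<longleftrightarrow> a < b"
  by (simp add: ordered_group_embedding_def strict_mono_less)

lemma embedding_le_iff: "ordered_group_embedding f \<Longrightarrow> f a \<le> f b \<longleftrightarrow> a \<le> b"
  by (simp add: ordered_group_embedding_def strict_mono_less_eq)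

lemma embedding_minus:
  assumes "ordered_group_embedding f"
  shows "f (- a) = - f a"
proof -
  have "f (- a + a) = f (- a) + f a"
    using assms unfolding ordered_group_embedding_def by blast
  then show ?thesis
    using embedding_nmult[OF assms, of 0] by (simp add: eq_neg_iff_add_eq_0)
qed

lemma embedding_position_mem:
  assumes f: "ordered_group_embedding f" and n: "0 < n"
  shows "frac a n \<in> {frac a n |a n. 0 < n \<and> f a < nmult n c} \<longleftrightarrow> f a < nmult n c"
    and "frac a n \<in> {frac a n |a n. 0 < n \<and> nmult n c < f a} \<longleftrightarrow> nmult n c < f a"
proof -
  have *: "(f a < nmult n c \<longleftrightarrow> f b < nmult m c) \<and> (nmult n c < f a \<longleftrightarrow> nmult m c < f b)"
    if "frac a n = frac b m" "0 < m" for b m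
  proof -
    have e: "nmult m (f a) = nmult n (f b)"
      using that n by (metis frac_eq_frac_iff embedding_nmult[OF f])
    have "f a < nmult n c \<longleftrightarrow> nmult m (f a) < nmult m (nmult n c)"
      using that by (simp add: nmult_less_iff)
    also have "\<dots> \<longleftrightarrow> nmult n (f b) < nmult n (nmult m c)"
      by (simp add: e nmult_commute)
    finally have 1: "f a < nmult n c \<longleftrightarrow> f b < nmult m c" using n by (simp add: nmult_less_iff)
    have "nmult n c < f a \<longleftrightarrow> nmult m (nmult n c) < nmult m (f a)"
      using that by (simp add: nmult_less_iff)
    also have "\<dots> \<longleftrightarrow> nmult n (nmult m c) < nmult n (f b)"
      by (simp add: e nmult_commute)
    finally show ?thesis using 1 n by (simp add: nmult_less_iff)
  qed
  show "frac a n \<in> {frac a n |a n. 0 < n \<and> f a < nmult n c} \<longleftrightarrow> f a < nmult n c"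
    "frac a n \<in> {frac a n |a n. 0 < n \<and> nmult n c < f a} \<longleftrightarrow> nmult n c < f a"
    using * n by blast+
qed

lemma is_position_ranger_of:
  assumes f: "ordered_group_embedding f"
  shows "is_position
     ({frac a n |a n. 0 < n \<and> f a < nmult n c}, {frac a n |a n. 0 < n \<and> nmult n c < f a})"
    (is "is_position (?L, ?U)")
  unfolding is_position_def fst_conv snd_conv
proof (intro conjI ballI allI impI)
  fix p q assume p: "p \<in> ?L" and le: "q \<le> p"
  obtain a m where a: "p = frac a m" "0 < m" by (rule frac_cases)
  obtain b n where b: "q = frac b n" "0 < n" by (rule frac_cases)
  have "nmult m (f b) \<le> nmult n (f a)"
    using le a b by (simp add: frac_le_frac_iff flip: embedding_nmult[OF f] embedding_le_iff[OF f])
  also have "\<dots> < nmult n (nmult m c)"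
    using p a b embedding_position_mem(1)[OF f] by (simp add: nmult_less_iff)
  finally show "q \<in> ?L"
    using a b embedding_position_mem(1)[OF f] by (simp add: nmult_less_iff nmult_commute[of n m])
next
  fix p q assume p: "p \<in> ?U" and le: "p \<le> q"
  obtain a m where a: "p = frac a m" "0 < m" by (rule frac_cases)
  obtain b n where b: "q = frac b n" "0 < n" by (rule frac_cases)
  have "nmult n (nmult m c) < nmult n (f a)"
    using p a b embedding_position_mem(2)[OF f] by (simp add: nmult_less_iff)
  also have "nmult n (f a) \<le> nmult m (f b)"
    using le a b by (simp add: frac_le_frac_iff flip: embedding_nmult[OF f] embedding_le_iff[OF f])
  finally show "q \<in> ?U"
    using a b embedding_position_mem(2)[OF f] by (simp add: nmult_less_iff nmult_commute[of n m])
next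
  show "?L \<inter> ?U = {}"
  proof (intro equals0I)
    fix p assume p: "p \<in> ?L \<inter> ?U"
    obtain a m where a: "p = frac a m" "0 < m" by (rule frac_cases)
    then show False using p embedding_position_mem[OF f, of m a c] by auto
  qed
next
  fix p q assume p: "p \<notin> ?L \<union> ?U" and q: "q \<notin> ?L \<union> ?U"
  obtain a m where a: "p = frac a m" "0 < m" by (rule frac_cases)
  obtain b n where b: "q = frac b n" "0 < n" by (rule frac_cases)
  have "f a = nmult m c" "f b = nmult n c"
    using p q a b embedding_position_mem[OF f, of m a c] embedding_position_mem[OF f, of n b c]
    by auto
  then have "f (nmult n a) = f (nmult m b)"
    by (simp add: embedding_nmult[OF f] nmult_commute)
  then have "nmult n a = nmult m b"
    by (metis embedding_less_iff[OF f] less_irrefl linorder_neqE)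
  then show "p = q" using a b by (simp add: frac_eq_frac_iff)
qed

lemma mem_ranger_of:
  assumes f: "ordered_group_embedding f" and n: "0 < n"
  shows "frac a n \<in> hull_below (ranger_of f c) \<longleftrightarrow> f a < nmult n c"
    and "frac a n \<in> hull_above (ranger_of f c) \<longleftrightarrow> nmult n c < f a"
  using embedding_position_mem[OF f n]
  by (simp_all add: ranger_of_def below_Abs_ranger above_Abs_ranger is_position_ranger_of[OF f])

lemma ranger_of_eq_iff_aux:
  assumes f: "ordered_group_embedding f" and g: "ordered_group_embedding g"
    and eq: "ranger_of f c = ranger_of g d"
  shows "f a + nmult m c - nmult n c < f b + nmult k c - nmult l c \<longleftrightarrow>
         g a + nmult m d - nmult n d < g b + nmult k d - nmult l d"
proof -
  have *: "(h a + nmult m e - nmult n e < h b + nmult k e - nmult l e) =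
      (if m + l = n + k then a < b
       else if m + l < n + k then h (a - b) < nmult (n + k - (m + l)) e
       else nmult (m + l - (n + k)) e < h (b - a))" (is "?lhs = ?rhs")
    if h: "ordered_group_embedding h"
    for e :: "'x::linordered_ab_group_add" and h :: "'a \<Rightarrow> 'x"
  proof -
    have hd: "h (u - v) = h u - h v" for u v
      using h embedding_minus[OF h, of v] unfolding ordered_group_embedding_def
      by (metis add_uminus_conv_diff)
    have 1: "?lhs \<longleftrightarrow> h a + nmult (m + l) e < h b + nmult (n + k) e"
    proof -
      have "?lhs \<longleftrightarrow> h a + nmult m e - nmult n e + (nmult n e + nmult l e)
          < h b + nmult k e - nmult l e + (nmult n e + nmult l e)"
        by (simp only: add_less_cancel_right)
      then show ?thesis by (simp add: nmult_add_left algebra_simps)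
    qed
    consider "m + l = n + k" | j where "n + k = (m + l) + j" "0 < j"
      | j where "m + l = (n + k) + j" "0 < j"
      by (metis less_imp_add_positive linorder_neqE_nat)
    then show ?thesis
    proof cases
      case 1
      then show ?thesis unfolding \<open>?lhs \<longleftrightarrow> _\<close> by (simp add: embedding_less_iff[OF h])
    next
      case (2 j)
      have "nmult (n + k) e = nmult (m + l) e + nmult j e"
        unfolding 2 by (rule nmult_add_left)
      then have "?lhs \<longleftrightarrow> nmult (m + l) e + h a < nmult (m + l) e + (h b + nmult j e)"
        unfolding \<open>?lhs \<longleftrightarrow> _\<close> by (simp add: ac_simps)
      then have "?lhs \<longleftrightarrow> h a - h b < nmult j e"
        unfolding add_less_cancel_left by (simp add: algebra_simps)
      with 2 show ?thesis by (simp add: hd)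
    next
      case (3 j)
      have "nmult (m + l) e = nmult (n + k) e + nmult j e"
        unfolding 3 by (rule nmult_add_left)
      then have "?lhs \<longleftrightarrow> nmult (n + k) e + (h a + nmult j e) < nmult (n + k) e + h b"
        unfolding \<open>?lhs \<longleftrightarrow> _\<close> by (simp add: ac_simps)
      then have "?lhs \<longleftrightarrow> nmult j e < h b - h a"
        unfolding add_less_cancel_left by (simp add: algebra_simps)
      with 3 show ?thesis by (simp add: hd)
    qed
  qed
  have "f u < nmult j c \<longleftrightarrow> g u < nmult j d" "nmult j c < f u \<longleftrightarrow> nmult j d < g u"
    if "0 < j" for u j
    using mem_ranger_of[OF f that, of u c] mem_ranger_of[OF g that, of u d] eq by simp_all
  then show ?thesis unfolding *[OF f] *[OF g] by simp
qed

text \<open>Two embeddings with a distinguished element define the same position if and only if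
  the ordered subgroups they generate are isomorphic over the given group, compatibly with the
  distinguished elements.\<close>

theorem ranger_of_eq_iff:
  fixes f :: "'a::linordered_ab_group_add \<Rightarrow> 'b::linordered_ab_group_add"
    and g :: "'a \<Rightarrow> 'c::linordered_ab_group_add"
  assumes f: "ordered_group_embedding f" and g: "ordered_group_embedding g"
  shows "ranger_of f c = ranger_of g d \<longleftrightarrow>
    (\<exists>h. strict_mono_on (group_adjoin f c) h \<and> h ` group_adjoin f c = group_adjoin g d \<and>
         (\<forall>u\<in>group_adjoin f c. \<forall>v\<in>group_adjoin f c. h (u + v) = h u + h v) \<and>
         (\<forall>a. h (f a) = g a) \<and> h c = d)"
proof
  assume eq: "ranger_of f c = ranger_of g d"
  note less = ranger_of_eq_iff_aux[OF f g eq]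
  define \<phi> where "\<phi> = (\<lambda>(a, m, n). f a + nmult m c - nmult n c)"
  define \<psi> where "\<psi> = (\<lambda>(a, m, n). g a + nmult m d - nmult n d)"
  have less': "\<phi> s < \<phi> t \<longleftrightarrow> \<psi> s < \<psi> t" for s t
    using less by (cases s, cases t) (simp add: \<phi>_def \<psi>_def)
  define h where "h = (\<lambda>u. \<psi> (inv_into UNIV \<phi> u))"
  have h: "h (\<phi> s) = \<psi> s" for s
  proof -
    have "\<phi> (inv_into UNIV \<phi> (\<phi> s)) = \<phi> s" by (simp add: f_inv_into_f)
    then show ?thesis unfolding h_def
      by (metis less' less_irrefl linorder_neqE)
  qed
  have F: "group_adjoin f c = range \<phi>"
    unfolding group_adjoin_def \<phi>_def image_def by (simp add: split_paired_Ex)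
  have G: "group_adjoin g d = range \<psi>"
    unfolding group_adjoin_def \<psi>_def image_def by (simp add: split_paired_Ex)
  have f0: "f 0 = 0" "g 0 = 0"
    using embedding_nmult[OF f, of 0] embedding_nmult[OF g, of 0] by simp_all
  have fg: "f (a + b) = f a + f b" "g (a + b) = g a + g b" for a b
    using f g by (simp_all add: ordered_group_embedding_def)
  show "\<exists>h. strict_mono_on (group_adjoin f c) h \<and> h ` group_adjoin f c = group_adjoin g d \<and>
         (\<forall>u\<in>group_adjoin f c. \<forall>v\<in>group_adjoin f c. h (u + v) = h u + h v) \<and>
         (\<forall>a. h (f a) = g a) \<and> h c = d"
  proof (intro exI[of _ h] conjI allI ballI)
    show "strict_mono_on (group_adjoin f c) h"
      unfolding F by (auto simp: strict_mono_on_def h less')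
    show "h ` group_adjoin f c = group_adjoin g d"
      unfolding F G by (simp add: image_image h)
    show "h (f a) = g a" for a
      using h[of "(a, 0, 0)"] by (simp add: \<phi>_def \<psi>_def)
    show "h c = d"
      using h[of "(0, 1, 0)"] by (simp add: \<phi>_def \<psi>_def f0)
    fix u v assume "u \<in> group_adjoin f c" "v \<in> group_adjoin f c"
    then obtain a m n b k l where uv: "u = \<phi> (a, m, n)" "v = \<phi> (b, k, l)"
      unfolding F by auto
    have "u + v = \<phi> (a + b, m + k, n + l)"
      by (simp add: uv \<phi>_def fg nmult_add_left)
    moreover have "\<psi> (a, m, n) + \<psi> (b, k, l) = \<psi> (a + b, m + k, n + l)"
      by (simp add: \<psi>_def fg nmult_add_left)
    ultimately show "h (u + v) = h u + h v"
      by (simp add: uv h)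
  qed
next
  assume "\<exists>h. strict_mono_on (group_adjoin f c) h \<and> h ` group_adjoin f c = group_adjoin g d \<and>
         (\<forall>u\<in>group_adjoin f c. \<forall>v\<in>group_adjoin f c. h (u + v) = h u + h v) \<and>
         (\<forall>a. h (f a) = g a) \<and> h c = d"
  then obtain h where mono: "strict_mono_on (group_adjoin f c) h"
    and add: "\<And>u v. u \<in> group_adjoin f c \<Longrightarrow> v \<in> group_adjoin f c \<Longrightarrow> h (u + v) = h u + h v"
    and hf: "\<And>a. h (f a) = g a" and hc: "h c = d"
    by blast
  have fin: "f a \<in> group_adjoin f c" for a
    unfolding group_adjoin_def by (rule CollectI, rule exI[of _ a], rule exI[of _ 0],
      rule exI[of _ 0]) simp
  have f0: "f 0 = 0" "g 0 = 0"
    using embedding_nmult[OF f, of 0] embedding_nmult[OF g, of 0] by simp_all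
  have nin: "nmult n c \<in> group_adjoin f c" for n
    unfolding group_adjoin_def by (rule CollectI, rule exI[of _ 0], rule exI[of _ n],
      rule exI[of _ 0]) (simp add: f0)
  have hn: "h (nmult n c) = nmult n d" for n
  proof (induction n)
    case 0
    then show ?case using hf[of 0] by (simp add: f0)
  next
    case (Suc n)
    then show ?case using add[OF nin[of 1] nin[of n]] by (simp add: hc)
  qed
  have iff: "u < v \<longleftrightarrow> h u < h v" if "u \<in> group_adjoin f c" "v \<in> group_adjoin f c" for u v
    using that mono by (meson strict_mono_on_less)
  have "f a < nmult n c \<longleftrightarrow> g a < nmult n d" "nmult n c < f a \<longleftrightarrow> nmult n d < g a" for a n
    using iff[OF fin nin, of a n] iff[OF nin fin, of n a] by (simp_all add: hf hn)
  then show "ranger_of f c = ranger_of g d"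
    by (simp add: ranger_of_def)
qed

lemma linordered_group_of_cone:
  fixes P :: "'g::ab_group_add \<Rightarrow> bool"
  assumes zero: "\<not> P 0" and add: "\<And>x y. P x \<Longrightarrow> P y \<Longrightarrow> P (x + y)"
    and total: "\<And>x. x \<noteq> 0 \<Longrightarrow> P x \<or> P (- x)"
  shows "class.linordered_ab_group_add (+) 0 (-) uminus
    (\<lambda>x y. x = y \<or> P (y - x)) (\<lambda>x y. P (y - x))"
proof
  fix x y z :: 'g
  have neg: False if "P (x - y)" "P (y - x)" for x y
    using add[OF that] zero by simp
  show "P (y - x) \<longleftrightarrow> (x = y \<or> P (y - x)) \<and> \<not> (y = x \<or> P (x - y))"
    using zero neg by auto
  show "x = x \<or> P (x - x)" by simp
  show "x = z \<or> P (z - x)" if "x = y \<or> P (y - x)" "y = z \<or> P (z - y)"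
    using that add[of "y - x" "z - y"] by auto
  show "x = y" if "x = y \<or> P (y - x)" "y = x \<or> P (x - y)"
    using that neg by auto
  show "z + x = z + y \<or> P (z + y - (z + x))" if "x = y \<or> P (y - x)"
    using that by auto
  show "(x = y \<or> P (y - x)) \<or> (y = x \<or> P (x - y))"
    using total[of "y - x"] by auto
qed

lemma nmult_pair: "nmult n (x, y) = (nmult n x, nmult n y)"
  by (induction n) (auto simp: zero_prod_def)

lemma nmult_int: "nmult n (k :: int) = int n * k"
  by (induction n) (auto simp: algebra_simps)

text \<open>Every position comes from an embedding into an ordered group, whose order is a suitable
  order on the product of the divisible hull with the integers.\<close>

theorem ranger_realised:
  fixes r :: "'a::linordered_ab_group_add ranger"
  shows "\<exists>le lt (f :: 'a \<Rightarrow> 'a divisible_hull \<times> int) c.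
    class.linordered_ab_group_add (+) 0 (-) uminus le lt \<and>
    (\<forall>a b. f (a + b) = f a + f b) \<and> (\<forall>a b. a < b \<longrightarrow> lt (f a) (f b)) \<and>
    hull_below r = {frac a n |a n. 0 < n \<and> lt (f a) (nmult n c)} \<and>
    hull_above r = {frac a n |a n. 0 < n \<and> lt (nmult n c) (f a)}"
proof -
  have reduce: ?thesis
    if zero: "\<not> P 0" and add: "\<And>x y. P x \<Longrightarrow> P y \<Longrightarrow> P (x + y)"
      and total: "\<And>x. x \<noteq> 0 \<Longrightarrow> P x \<or> P (- x)"
      and pos: "\<And>p. 0 < p \<Longrightarrow> P (p, 0)"
      and below: "\<And>a n. 0 < n \<Longrightarrow> P (nmult n c - (frac a 1, 0)) \<longleftrightarrow> frac a n \<in> hull_below r"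
      and above: "\<And>a n. 0 < n \<Longrightarrow> P ((frac a 1, 0) - nmult n c) \<longleftrightarrow> frac a n \<in> hull_above r"
    for P :: "'a divisible_hull \<times> int \<Rightarrow> bool" and c
  proof -
    define f :: "'a \<Rightarrow> 'a divisible_hull \<times> int" where "f = (\<lambda>a. (frac a 1, 0))"
    have "f (a + b) = f a + f b" for a b
      by (simp add: f_def frac_add_one del: One_nat_def)
    moreover have "P (f b - f a)" if "a < b" for a b
      using pos[of "frac b 1 - frac a 1"] that by (simp add: f_def frac_less_frac_iff)
    moreover have "hull_below r = {frac a n |a n. 0 < n \<and> P (nmult n c - f a)}"
    proof (intro equalityI subsetI)
      fix p assume p: "p \<in> hull_below r"
      obtain a n where "p = frac a n" "0 < n" by (rule frac_cases)
      then show "p \<in> {frac a n |a n. 0 < n \<and> P (nmult n c - f a)}"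
        using p below by (auto simp: f_def)
    qed (use below in \<open>auto simp: f_def\<close>)
    moreover have "hull_above r = {frac a n |a n. 0 < n \<and> P (f a - nmult n c)}"
    proof (intro equalityI subsetI)
      fix p assume p: "p \<in> hull_above r"
      obtain a n where "p = frac a n" "0 < n" by (rule frac_cases)
      then show "p \<in> {frac a n |a n. 0 < n \<and> P (f a - nmult n c)}"
        using p above by (auto simp: f_def)
    qed (use above in \<open>auto simp: f_def\<close>)
    ultimately show ?thesis
      using linordered_group_of_cone[OF zero add total] by blast
  qed
  have nf: "frac a 1 = nmult n (frac a n)" if "0 < n" for a :: 'a and n
    using that by (simp add: nmult_frac frac_eq_frac_iff)
  show ?thesis
  proof (cases "hull_below r \<union> hull_above r = UNIV")
    case False
    then obtain q where r: "r = divisorial q" using divisorial_of_missing by blast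
    define P :: "'a divisible_hull \<times> int \<Rightarrow> bool" where
      "P = (\<lambda>(p, k). 0 < p \<or> p = 0 \<and> 0 < k)"
    show ?thesis
    proof (rule reduce[of P "(q, 0)"])
      show "\<not> P 0" by (simp add: P_def zero_prod_def)
      show "P (x + y)" if "P x" "P y" for x y
        using that by (cases x, cases y) (auto simp: P_def add_pos_pos)
      show "P x \<or> P (- x)" if "x \<noteq> 0" for x
        using that by (cases x) (auto simp: P_def zero_prod_def)
      show "P (p, 0)" if "0 < p" for p
        using that by (simp add: P_def)
      fix a :: 'a and n :: nat assume n: "0 < n"
      show "P (nmult n (q, 0) - (frac a 1, 0)) \<longleftrightarrow> frac a n \<in> hull_below r"
        using n by (simp add: P_def r nmult_pair nf[OF n] nmult_less_iff del: One_nat_def)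
      show "P ((frac a 1, 0) - nmult n (q, 0)) \<longleftrightarrow> frac a n \<in> hull_above r"
        using n by (simp add: P_def r nmult_pair nf[OF n] nmult_less_iff del: One_nat_def)
    qed
  next
    case True
    define P :: "'a divisible_hull \<times> int \<Rightarrow> bool" where
      "P = (\<lambda>(p, k). if k = 0 then 0 < p
         else if 0 < k then \<exists>x\<in>hull_below r. 0 \<le> p + nmult (nat k) x
         else \<exists>x\<in>hull_above r. nmult (nat (- k)) x \<le> p)"
    have P0: "P (p, 0) \<longleftrightarrow> 0 < p" for p by (simp add: P_def)
    have Ppos: "P (p, int n) \<longleftrightarrow> (\<exists>x\<in>hull_below r. 0 \<le> p + nmult n x)" if "0 < n" for p n
      using that by (simp add: P_def)
    have Pneg: "P (p, - int n) \<longleftrightarrow> (\<exists>x\<in>hull_above r. nmult n x \<le> p)" if "0 < n" for p n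
      using that by (simp add: P_def)
    have lt: "x < y" if "x \<in> hull_below r" "y \<in> hull_above r" for x y
      using that below_downward below_above_disjoint by (meson linorder_not_less)
    have int_cases: thesis
      if "k = 0 \<Longrightarrow> thesis" "\<And>n. 0 < n \<Longrightarrow> k = int n \<Longrightarrow> thesis"
        "\<And>n. 0 < n \<Longrightarrow> k = - int n \<Longrightarrow> thesis" for k :: int and thesis
      using that by (cases k rule: int_cases3) auto
    have mixed: "P (p + q, int m - int n)"
      if mn: "0 < m" "0 < n" and p: "P (p, int m)" and q: "P (q, - int n)" for p q m n
    proof -
      obtain x where x: "x \<in> hull_below r" "0 \<le> p + nmult m x" using p mn by (auto simp: Ppos)
      obtain y where y: "y \<in> hull_above r" "nmult n y \<le> q" using q mn by (auto simp: Pneg)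
      have xy: "nmult n x < nmult n y" "nmult m x < nmult m y"
        using lt[OF x(1) y(1)] mn by (simp_all add: nmult_less_iff)
      consider "m = n" | j where "m = n + j" "0 < j" | j where "n = m + j" "0 < j"
        by (metis less_imp_add_positive linorder_neqE_nat)
      then show ?thesis
      proof cases
        case 1
        have "0 \<le> p + nmult m x" by (rule x)
        also have "\<dots> < p + nmult m y" using xy by simp
        also have "\<dots> \<le> p + q" using y 1 by simp
        finally show ?thesis using 1 by (simp add: P0)
      next
        case (2 j)
        have "0 \<le> p + nmult m x" by (rule x)
        also have "\<dots> = p + nmult n x + nmult j x" by (simp add: 2 nmult_add_left add.assoc)
        also have "\<dots> \<le> p + q + nmult j x" using xy(1) y(2) by simp
        finally have "P (p + q, int j)" using x 2 by (auto simp: Ppos)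
        then show ?thesis using 2 by simp
      next
        case (3 j)
        have "nmult j y \<le> nmult j y + (p + nmult m x)" using x by simp
        also have "\<dots> \<le> nmult j y + (p + nmult m y)" using xy by simp
        also have "\<dots> = p + nmult n y" by (simp add: 3 nmult_add_left ac_simps)
        also have "\<dots> \<le> p + q" using y by simp
        finally have "P (p + q, - int j)" using y 3 by (auto simp: Pneg)
        then show ?thesis using 3 by simp
      qed
    qed
    have zero_pos: "P (p + q, l)" if p: "P (p, 0)" and q: "P (q, l)" for p q l
    proof (cases l rule: int_cases)
      case 1
      then show ?thesis using p q by (simp add: P0 add_pos_pos)
    next
      case (2 n)
      then obtain x where "x \<in> hull_below r" "0 \<le> q + nmult n x" using q by (auto simp: Ppos)
      moreover from this have "0 \<le> p + q + nmult n x"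
        using p by (simp add: P0 add.assoc add_nonneg_nonneg)
      ultimately show ?thesis using 2 by (auto simp: Ppos)
    next
      case (3 n)
      then obtain x where "x \<in> hull_above r" "nmult n x \<le> q" using q by (auto simp: Pneg)
      moreover from this have "nmult n x \<le> p + q"
        using p add_mono[of 0 p "nmult n x" q] by (simp add: P0)
      ultimately show ?thesis using 3 by (auto simp: Pneg)
    qed
    have both_pos: "P (p + q, int (m + n))"
      if mn: "0 < m" "0 < n" and p: "P (p, int m)" and q: "P (q, int n)" for p q m n
    proof -
      obtain x where x: "x \<in> hull_below r" "0 \<le> p + nmult m x" using p mn by (auto simp: Ppos)
      obtain y where y: "y \<in> hull_below r" "0 \<le> q + nmult n y" using q mn by (auto simp: Ppos)
      have "0 \<le> (p + nmult m x) + (q + nmult n y)" using x y by simp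
      also have "\<dots> \<le> (p + nmult m (max x y)) + (q + nmult n (max x y))"
        by (intro add_mono nmult_mono) auto
      also have "\<dots> = p + q + nmult (m + n) (max x y)" by (simp add: nmult_add_left ac_simps)
      finally have "0 \<le> p + q + nmult (m + n) (max x y)" .
      moreover have "max x y \<in> hull_below r" using x y by (simp add: max_def)
      moreover have "0 < m + n" using mn by simp
      ultimately show ?thesis unfolding Ppos[OF \<open>0 < m + n\<close>] by blast
    qed
    have both_neg: "P (p + q, - int (m + n))"
      if mn: "0 < m" "0 < n" and p: "P (p, - int m)" and q: "P (q, - int n)" for p q m n
    proof -
      obtain x where x: "x \<in> hull_above r" "nmult m x \<le> p" using p mn by (auto simp: Pneg)
      obtain y where y: "y \<in> hull_above r" "nmult n y \<le> q" using q mn by (auto simp: Pneg)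
      have "nmult (m + n) (min x y) = nmult m (min x y) + nmult n (min x y)"
        by (rule nmult_add_left)
      also have "\<dots> \<le> nmult m x + nmult n y" by (intro add_mono nmult_mono) auto
      also have "\<dots> \<le> p + q" using x y by (intro add_mono)
      finally have "nmult (m + n) (min x y) \<le> p + q" .
      moreover have "min x y \<in> hull_above r" using x y by (simp add: min_def)
      moreover have "0 < m + n" using mn by simp
      ultimately show ?thesis unfolding Pneg[OF \<open>0 < m + n\<close>] by blast
    qed
    have divide: "\<exists>x. nmult n x = p" if "0 < n" for n and p :: "'a divisible_hull"
      using that by (rule hull_divisible)
    have total_pos: "P (p, int n) \<or> P (- p, - int n)" if n: "0 < n" for p n
    proof -
      obtain x where x: "nmult n x = - p" using divide[OF n] by blast
      show ?thesis
      proof (cases "x \<in> hull_below r")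
        case True
        then show ?thesis using x n by (auto simp: Ppos intro!: bexI[of _ x])
      next
        case False
        then have "x \<in> hull_above r" using True \<open>hull_below r \<union> hull_above r = UNIV\<close> by blast
        then show ?thesis using x n by (auto simp: Pneg intro!: bexI[of _ x])
      qed
    qed
    show ?thesis
    proof (rule reduce[of P "(0, 1)"])
      show "\<not> P 0" by (simp add: P0 zero_prod_def)
      show "P (x + y)" if x: "P x" and y: "P y" for x y
      proof -
        obtain p k where pk: "x = (p, k)" by (cases x)
        obtain q l where ql: "y = (q, l)" by (cases y)
        have "P (p + q, k + l)"
        proof (cases k rule: int_cases)
          case 1
          then show ?thesis using zero_pos[of p q l] x y pk ql by simp
        next
          case k: (2 m)
          show ?thesis
          proof (cases l rule: int_cases)
            case 1
            then show ?thesis using zero_pos[of q p k] x y pk ql by (simp add: add.commute)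
          next
            case (2 n)
            then show ?thesis using both_pos[of m n p q] k x y pk ql by simp
          next
            case (3 n)
            then show ?thesis using mixed[of m n p q] k x y pk ql by simp
          qed
        next
          case k: (3 m)
          show ?thesis
          proof (cases l rule: int_cases)
            case 1
            then show ?thesis using zero_pos[of q p k] x y pk ql by (simp add: add.commute)
          next
            case (2 n)
            then show ?thesis using mixed[of n m q p] k x y pk ql by (simp add: add.commute)
          next
            case (3 n)
            then show ?thesis using both_neg[of m n p q] k x y pk ql by (simp add: add.commute)
          qed
        qed
        then show ?thesis by (simp add: pk ql)
      qed
      show "P x \<or> P (- x)" if "x \<noteq> 0" for x
      proof -
        obtain p k where pk: "x = (p, k)" by (cases x)
        have "P (p, k) \<or> P (- p, - k)"
        proof (cases k rule: int_cases)
          case 1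
          then show ?thesis using that by (auto simp: pk P0 zero_prod_def)
        next
          case (2 n)
          then show ?thesis using total_pos[of n p] by simp
        next
          case (3 n)
          then show ?thesis using total_pos[of n "- p"] by auto
        qed
        then show ?thesis by (simp add: pk)
      qed
      show "P (p, 0)" if "0 < p" for p
        using that by (simp add: P0)
      fix a :: 'a and n :: nat assume n: "0 < n"
      have "nmult n (0 :: 'a divisible_hull, 1 :: int) - (frac a 1, 0) = (- frac a 1, int n)"
        by (simp add: nmult_pair nmult_int)
      then show "P (nmult n (0, 1) - (frac a 1, 0)) \<longleftrightarrow> frac a n \<in> hull_below r"
        using n below_downward[of _ r "frac a n"]
        by (auto simp: Ppos nf[OF n] nmult_le_iff simp del: One_nat_def)
      have "(frac a 1, 0) - nmult n (0 :: 'a divisible_hull, 1 :: int) = (frac a 1, - int n)"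
        by (simp add: nmult_pair nmult_int)
      then show "P ((frac a 1, 0) - nmult n (0, 1)) \<longleftrightarrow> frac a n \<in> hull_above r"
        using n above_upward[of _ r "frac a n"]
        by (auto simp: Pneg nf[OF n] nmult_le_iff simp del: One_nat_def)
    qed
  qed
qed


section \<open>The ranger topology\<close>

definition ranger_base :: "'a::linordered_ab_group_add ranger set set" where
  "ranger_base = {{a..b} |a b.
     (is_divisorial a \<or> is_unbounded a) \<and> (is_divisorial b \<or> is_unbounded b) \<and>
     \<not> (a = b \<and> is_unbounded a)}"

definition ranger_topology :: "'a::linordered_ab_group_add ranger topology" where
  "ranger_topology = topology (arbitrary union_of (\<lambda>U. U \<in> ranger_base))"

lemma ranger_base_Int:
  assumes "S \<in> ranger_base" "T \<in> ranger_base"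
  shows "S \<inter> T \<in> ranger_base"
proof -
  obtain a b where S: "S = {a..b}" "is_divisorial a \<or> is_unbounded a"
    "is_divisorial b \<or> is_unbounded b" "\<not> (a = b \<and> is_unbounded a)"
    using assms(1) by (auto simp: ranger_base_def)
  obtain c d where T: "T = {c..d}" "is_divisorial c \<or> is_unbounded c"
    "is_divisorial d \<or> is_unbounded d" "\<not> (c = d \<and> is_unbounded c)"
    using assms(2) by (auto simp: ranger_base_def)
  have "\<not> (max a c = min b d \<and> is_unbounded (max a c))"
  proof
    assume *: "max a c = min b d \<and> is_unbounded (max a c)"
    then consider "max a c = minus_infinity" "min b d = minus_infinity"
      | "max a c = plus_infinity" "min b d = plus_infinity"
      by (auto simp: is_unbounded_def)
    then show False
    proof cases
      case 1
      then have "a = minus_infinity" "c = minus_infinity"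
        by (metis antisym max.cobounded1 minus_infinity_le, metis antisym max.cobounded2 minus_infinity_le)
      moreover have "b = minus_infinity \<or> d = minus_infinity"
        using 1(2) by (auto simp: min_def split: if_splits)
      ultimately show False using S T by (auto simp: is_unbounded_def)
    next
      case 2
      then have "b = plus_infinity" "d = plus_infinity"
        by (metis antisym min.cobounded1 le_plus_infinity, metis antisym min.cobounded2 le_plus_infinity)
      moreover have "a = plus_infinity \<or> c = plus_infinity"
        using 2(1) by (auto simp: max_def split: if_splits)
      ultimately show False using S T by (auto simp: is_unbounded_def)
    qed
  qed
  moreover have "S \<inter> T = {max a c..min b d}" by (auto simp: S T)
  moreover have "is_divisorial (max a c) \<or> is_unbounded (max a c)"
    "is_divisorial (min b d) \<or> is_unbounded (min b d)"
    using S T by (auto simp: max_def min_def)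
  ultimately show ?thesis unfolding ranger_base_def by blast
qed

lemma openin_ranger_topology:
  "openin ranger_topology = arbitrary union_of (\<lambda>U. U \<in> ranger_base)"
  unfolding ranger_topology_def
  by (rule topology_inverse', rule istopology_base) (rule ranger_base_Int)

lemma topspace_ranger_topology [simp]: "topspace ranger_topology = UNIV"
proof -
  have "minus_infinity \<noteq> (plus_infinity :: 'a ranger)"
    by (simp add: ranger_eq_iff)
  then have "{minus_infinity..plus_infinity :: 'a ranger} \<in> ranger_base"
    unfolding ranger_base_def is_unbounded_def by blast
  moreover have "{minus_infinity..plus_infinity :: 'a ranger} = UNIV"
    by auto
  ultimately have "openin ranger_topology (UNIV :: 'a ranger set)"
    by (simp add: openin_ranger_topology union_of_inc arbitrary_def)
  then show ?thesis by (simp add: openin_topspace topspace_def) blast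
qed


section \<open>Hausdorff quotients and order topologies\<close>

definition quotient_topology :: "'a topology \<Rightarrow> ('a \<times> 'a) set \<Rightarrow> 'a set topology" where
  "quotient_topology X E = topology (\<lambda>V. V \<subseteq> topspace X // E \<and> openin X (\<Union> V))"

text \<open>The smallest equivalence relation with Hausdorff quotient. Its quotient is again Hausdorff and
  has the universal property for continuous maps into Hausdorff spaces; both are proved below.\<close>

definition max_hausdorff_rel :: "'a topology \<Rightarrow> ('a \<times> 'a) set" where
  "max_hausdorff_rel X =
     \<Inter>{E. equiv (topspace X) E \<and> Hausdorff_space (quotient_topology X E)}"

definition max_hausdorff_quotient :: "'a topology \<Rightarrow> 'a set topology" where
  "max_hausdorff_quotient X = quotient_topology X (max_hausdorff_rel X)"

lemma openin_quotient_topology: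
  assumes E: "equiv (topspace X) E"
  shows "openin (quotient_topology X E) V \<longleftrightarrow> V \<subseteq> topspace X // E \<and> openin X (\<Union> V)"
proof -
  have "istopology (\<lambda>V. V \<subseteq> topspace X // E \<and> openin X (\<Union> V))"
    unfolding istopology_def
  proof (intro conjI allI impI)
    fix S T assume S: "S \<subseteq> topspace X // E \<and> openin X (\<Union> S)"
      and T: "T \<subseteq> topspace X // E \<and> openin X (\<Union> T)"
    have "\<Union> (S \<inter> T) = \<Union> S \<inter> \<Union> T"
      using S T quotient_disj[OF E] by blast
    then show "openin X (\<Union> (S \<inter> T))" using S T by auto
    show "S \<inter> T \<subseteq> topspace X // E" using S by blast
  next
    fix \<K> assume K: "\<forall>K\<in>\<K>. K \<subseteq> topspace X // E \<and> openin X (\<Union> K)"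
    then show "\<Union> \<K> \<subseteq> topspace X // E" by blast
    have "openin X (\<Union> (Union ` \<K>))" using K by blast
    moreover have "\<Union> (Union ` \<K>) = \<Union> (\<Union> \<K>)" by blast
    ultimately show "openin X (\<Union> (\<Union> \<K>))" by simp
  qed
  then show ?thesis unfolding quotient_topology_def by (simp add: topology_inverse')
qed

lemma topspace_quotient_topology [simp]:
  assumes E: "equiv (topspace X) E"
  shows "topspace (quotient_topology X E) = topspace X // E"
proof -
  have "openin (quotient_topology X E) (topspace X // E)"
    by (simp add: openin_quotient_topology[OF E] Union_quotient[OF E])
  then show ?thesis
    using openin_quotient_topology[OF E] by (metis openin_subset openin_topspace subset_antisym)
qed

lemma quotient_map_quotient_topology:
  assumes E: "equiv (topspace X) E"
  shows "quotient_map X (quotient_topology X E) (\<lambda>x. E `` {x})"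
  unfolding quotient_map_def topspace_quotient_topology[OF E]
proof (intro conjI allI impI)
  show "(\<lambda>x. E `` {x}) ` topspace X = topspace X // E"
    by (auto simp: quotient_def)
  fix V assume V: "V \<subseteq> topspace X // E"
  have "{x \<in> topspace X. E `` {x} \<in> V} = \<Union> V"
  proof (intro equalityI subsetI)
    fix x assume "x \<in> {x \<in> topspace X. E `` {x} \<in> V}"
    then show "x \<in> \<Union> V" using equiv_class_self[OF E] by blast
  next
    fix x assume "x \<in> \<Union> V"
    then obtain C where C: "C \<in> V" "x \<in> C" by blast
    then have "C \<in> topspace X // E" using V by blast
    then obtain y where "C = E `` {y}" "y \<in> topspace X" by (rule quotientE)
    then show "x \<in> {x \<in> topspace X. E `` {x} \<in> V}"
      using C equiv_class_eq[OF E, of y x] equiv_type[OF E] by auto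
  qed
  then show "openin X {x \<in> topspace X. E `` {x} \<in> V} = openin (quotient_topology X E) V"
    using V by (simp add: openin_quotient_topology[OF E])
qed

lemma equiv_kernel: "equiv A {(x, y). x \<in> A \<and> y \<in> A \<and> f x = f y}"
  by (rule equivI) (auto simp: refl_on_def sym_def trans_def)

lemma max_hausdorff_rel_subset_kernel:
  assumes Z: "Hausdorff_space Z" and f: "continuous_map X Z f"
  shows "max_hausdorff_rel X \<subseteq> {(x, y). x \<in> topspace X \<and> y \<in> topspace X \<and> f x = f y}"
    (is "_ \<subseteq> ?E")
proof -
  have E: "equiv (topspace X) ?E" by (rule equiv_kernel)
  have open_sat: "openin (quotient_topology X ?E) {C \<in> topspace X // ?E. C \<subseteq> f -` U}"
    if "openin Z U" for U
  proof -
    have "\<Union> {C \<in> topspace X // ?E. C \<subseteq> f -` U} = {x \<in> topspace X. f x \<in> U}"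
    proof (intro equalityI subsetI)
      fix x assume "x \<in> \<Union> {C \<in> topspace X // ?E. C \<subseteq> f -` U}"
      then show "x \<in> {x \<in> topspace X. f x \<in> U}" by (auto simp: quotient_def)
    next
      fix x assume x: "x \<in> {x \<in> topspace X. f x \<in> U}"
      then have "?E `` {x} \<in> {C \<in> topspace X // ?E. C \<subseteq> f -` U}" by (auto simp: quotient_def)
      moreover have "x \<in> ?E `` {x}" using x by simp
      ultimately show "x \<in> \<Union> {C \<in> topspace X // ?E. C \<subseteq> f -` U}" by (rule UnionI)
    qed
    then show ?thesis
      using openin_continuous_map_preimage[OF f that] by (simp add: openin_quotient_topology[OF E])
  qed
  have "Hausdorff_space (quotient_topology X ?E)"
    unfolding Hausdorff_space_def topspace_quotient_topology[OF E]
  proof (intro allI impI, elim conjE)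
    fix C D assume C: "C \<in> topspace X // ?E" and D: "D \<in> topspace X // ?E" and "C \<noteq> D"
    obtain x where x: "x \<in> topspace X" "C = ?E `` {x}" using C by (rule quotientE)
    obtain y where y: "y \<in> topspace X" "D = ?E `` {y}" using D by (rule quotientE)
    have "f x \<noteq> f y" using \<open>C \<noteq> D\<close> x y by auto
    moreover have "f x \<in> topspace Z" "f y \<in> topspace Z"
      using f x y by (auto simp: continuous_map_def)
    ultimately obtain U V where UV: "openin Z U" "openin Z V" "f x \<in> U" "f y \<in> V" "disjnt U V"
      using Z unfolding Hausdorff_space_def by metis
    let ?U = "{C \<in> topspace X // ?E. C \<subseteq> f -` U}" and ?V = "{C \<in> topspace X // ?E. C \<subseteq> f -` V}"
    have "disjnt ?U ?V"
    proof (unfold disjnt_iff, intro allI notI, elim conjE)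
      fix B assume B: "B \<in> ?U" "B \<in> ?V"
      then have "B \<noteq> {}" using in_quotient_imp_non_empty[OF E] by blast
      then show False using B UV by (auto simp: disjnt_iff)
    qed
    moreover have "C \<in> ?U" "D \<in> ?V" using C D x y UV by auto
    ultimately show "\<exists>U V. openin (quotient_topology X ?E) U \<and>
        openin (quotient_topology X ?E) V \<and> C \<in> U \<and> D \<in> V \<and> disjnt U V"
      using open_sat UV by blast
  qed
  with E show ?thesis unfolding max_hausdorff_rel_def by blast
qed

lemma equiv_max_hausdorff_rel: "equiv (topspace X) (max_hausdorff_rel X)"
proof -
  let ?\<E> = "{E. equiv (topspace X) E \<and> Hausdorff_space (quotient_topology X E)}"
  have "continuous_map X (discrete_topology UNIV) (\<lambda>_. ())" by simp
  then have "max_hausdorff_rel X \<subseteq> topspace X \<times> topspace X"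
    using max_hausdorff_rel_subset_kernel[of "discrete_topology UNIV" X "\<lambda>_. ()"]
    by (auto simp: Hausdorff_space_discrete_topology)
  moreover have "refl_on (topspace X) (max_hausdorff_rel X)"
    unfolding max_hausdorff_rel_def refl_on_def by (auto dest: equivE simp: equiv_def refl_on_def)
  moreover have "sym (max_hausdorff_rel X)"
    unfolding max_hausdorff_rel_def by (rule symI) (auto simp: equiv_def dest: symD)
  moreover have "trans (max_hausdorff_rel X)"
    unfolding max_hausdorff_rel_def by (rule transI) (auto simp: equiv_def dest: transD)
  ultimately show ?thesis by (auto simp: equiv_def)
qed

lemma Hausdorff_max_hausdorff_quotient: "Hausdorff_space (max_hausdorff_quotient X)"
  unfolding max_hausdorff_quotient_def Hausdorff_space_def
    topspace_quotient_topology[OF equiv_max_hausdorff_rel]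
proof (intro allI impI, elim conjE)
  let ?M = "max_hausdorff_rel X"
  fix C D assume C: "C \<in> topspace X // ?M" and D: "D \<in> topspace X // ?M" and "C \<noteq> D"
  obtain x where x: "x \<in> topspace X" "C = ?M `` {x}" using C by (rule quotientE)
  obtain y where y: "y \<in> topspace X" "D = ?M `` {y}" using D by (rule quotientE)
  have "(x, y) \<notin> ?M" using \<open>C \<noteq> D\<close> x y equiv_class_eq[OF equiv_max_hausdorff_rel] by metis
  then obtain E where E: "equiv (topspace X) E" "Hausdorff_space (quotient_topology X E)"
    "(x, y) \<notin> E" by (auto simp: max_hausdorff_rel_def)
  have sub: "?M \<subseteq> E" using E unfolding max_hausdorff_rel_def by blast
  let ?q = "\<lambda>x. E `` {x}"
  have "?q x \<noteq> ?q y" using E x y eq_equiv_class by metis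
  moreover have "?q x \<in> topspace X // E" "?q y \<in> topspace X // E"
    using x y by (auto intro: quotientI)
  ultimately obtain U V where UV: "openin (quotient_topology X E) U"
    "openin (quotient_topology X E) V" "?q x \<in> U" "?q y \<in> V" "disjnt U V"
    using E(2) unfolding Hausdorff_space_def topspace_quotient_topology[OF E(1)] by metis
  have q: "continuous_map X (quotient_topology X E) ?q"
    by (rule quotient_imp_continuous_map[OF quotient_map_quotient_topology[OF E(1)]])
  let ?W = "\<lambda>U. {B \<in> topspace X // ?M. B \<subseteq> ?q -` U}"
  have self: "z \<in> ?M `` {z}" if "z \<in> topspace X" for z
    using that by (rule equiv_class_self[OF equiv_max_hausdorff_rel])
  have *: "?M `` {z} \<subseteq> ?q -` U \<longleftrightarrow> ?q z \<in> U" if z: "z \<in> topspace X" for z U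
  proof
    assume "?M `` {z} \<subseteq> ?q -` U"
    then show "?q z \<in> U" using self[OF z] by blast
  next
    assume U: "?q z \<in> U"
    show "?M `` {z} \<subseteq> ?q -` U"
    proof
      fix w assume "w \<in> ?M `` {z}"
      then have "(z, w) \<in> E" using sub by auto
      then have "?q z = ?q w" by (rule equiv_class_eq[OF E(1)])
      then show "w \<in> ?q -` U" using U by simp
    qed
  qed
  have W: "openin (quotient_topology X ?M) (?W U)" if "openin (quotient_topology X E) U" for U
  proof -
    have "\<Union> (?W U) = {z \<in> topspace X. ?q z \<in> U}"
    proof (intro equalityI subsetI)
      fix z assume "z \<in> \<Union> (?W U)"
      then obtain B where B: "z \<in> B" "B \<in> topspace X // ?M" "B \<subseteq> ?q -` U" by auto
      then have "z \<in> topspace X"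
        using in_quotient_imp_subset[OF equiv_max_hausdorff_rel B(2)] by auto
      then show "z \<in> {z \<in> topspace X. ?q z \<in> U}" using B by auto
    next
      fix z assume z: "z \<in> {z \<in> topspace X. ?q z \<in> U}"
      then have "?M `` {z} \<in> ?W U" using *[of z U] by (simp add: quotientI)
      moreover have "z \<in> ?M `` {z}" using z self by simp
      ultimately show "z \<in> \<Union> (?W U)" by (rule UnionI)
    qed
    then show ?thesis
      using openin_continuous_map_preimage[OF q that]
      by (simp add: openin_quotient_topology[OF equiv_max_hausdorff_rel])
  qed
  have "disjnt (?W U) (?W V)"
  proof (unfold disjnt_iff, intro allI notI, elim conjE)
    fix B assume B: "B \<in> ?W U" "B \<in> ?W V"
    then have "B \<noteq> {}" using in_quotient_imp_non_empty[OF equiv_max_hausdorff_rel] by blast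
    then show False using B UV by (auto simp: disjnt_iff)
  qed
  moreover have "C \<in> ?W U" "D \<in> ?W V"
    using C D UV *[OF x(1), of U] *[OF y(1), of V] by (simp_all add: x(2) y(2))
  ultimately show "\<exists>U V. openin (quotient_topology X ?M) U \<and>
      openin (quotient_topology X ?M) V \<and> C \<in> U \<and> D \<in> V \<and> disjnt U V"
    using W UV by blast
qed

theorem max_hausdorff_quotient_universal:
  assumes Z: "Hausdorff_space Z" and f: "continuous_map X Z f"
  shows "\<exists>g. continuous_map (max_hausdorff_quotient X) Z g \<and>
    (\<forall>x\<in>topspace X. g (max_hausdorff_rel X `` {x}) = f x)"
proof -
  let ?q = "\<lambda>x. max_hausdorff_rel X `` {x}"
  have q: "quotient_map X (max_hausdorff_quotient X) ?q"
    unfolding max_hausdorff_quotient_def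
    by (rule quotient_map_quotient_topology[OF equiv_max_hausdorff_rel])
  have eq: "f x = f y" if "x \<in> topspace X" "y \<in> topspace X" "?q x = ?q y" for x y
  proof -
    have "(x, y) \<in> max_hausdorff_rel X"
      using eq_equiv_class[OF that(3) equiv_max_hausdorff_rel that(2)] .
    then show ?thesis using max_hausdorff_rel_subset_kernel[OF Z f] by auto
  qed
  obtain g where g: "continuous_map (max_hausdorff_quotient X) Z g"
    "\<And>x. x \<in> topspace X \<Longrightarrow> g (?q x) = f x"
    by (rule quotient_map_lift_exists[OF q f eq]) auto
  then show ?thesis by blast
qed

definition order_topology_on :: "'a set \<Rightarrow> ('a \<times> 'a) set \<Rightarrow> 'a topology" where
  "order_topology_on S r = topology_generated_by
     ({S} \<union> (\<lambda>a. {x \<in> S. (a, x) \<in> r \<and> x \<noteq> a}) ` S \<union> (\<lambda>a. {x \<in> S. (x, a) \<in> r \<and> x \<noteq> a}) ` S)"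

text \<open>On a partition into convex sets this is the induced linear order on the blocks.\<close>

definition quotient_order :: "'a::linorder set set \<Rightarrow> ('a set \<times> 'a set) set" where
  "quotient_order S = {(A, B). A \<in> S \<and> B \<in> S \<and> (\<exists>a\<in>A. \<exists>b\<in>B. a \<le> b)}"

text \<open>The equivalence relation generated by identifying any two points of the closure of a common
  divisorial ranger; the generating relation is symmetric.\<close>

definition closure_identification :: "('a::linordered_ab_group_add ranger \<times> 'a ranger) set" where
  "closure_identification =
     (\<Union>q. (ranger_topology closure_of {divisorial q}) \<times> (ranger_topology closure_of {divisorial q}))\<^sup>*"

end

theory Submission
  imports Defs
begin

text \<open>Rangers form a complete order, and every neighbourhood of an infinitesimal ranger
  \<open>q\<^sup>+\<close> or \<open>q\<^sup>-\<close> contains \<open>q\<close>. Hence real induction works for rangers: a transitive relation that holds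
  locally around each point relates the endpoints of every interval. Applied to ``the interval has a
  finite subcover'' and to ``both endpoints lie on the same side of a separation'', this gives
  compactness and the connectedness of convex sets. Two rangers are identified in the Hausdorff
  quotient exactly when the interval between them contains at most one divisorial ranger. Since the
  divisible hull is dense, the order topology on the blocks is Hausdorff. It is coarser than the
  compact quotient topology, so the two coincide.\<close>

section \<open>The order on rangers\<close>

text \<open>Divisibility by two provides the midpoint of \<open>p\<close> and
  \<open>q\<close>.\<close>

lemma divisible_hull_dense:
  fixes p q :: "'a::linordered_ab_group_add divisible_hull"
  assumes "p < q"
  shows "\<exists>m. p < m \<and> m < q"
proof -
  obtain m where m: "nmult 2 m = p + q"
    using hull_divisible[of 2 "p + q"] by auto
  have two: "nmult 2 x = x + x" for x :: "'a divisible_hull"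
    by (simp add: numeral_2_eq_2)
  have "nmult 2 p < p + q" "p + q < nmult 2 q"
    unfolding two using assms by simp_all
  then have "nmult 2 p < nmult 2 m" "nmult 2 m < nmult 2 q"
    by (simp_all only: m)
  then show ?thesis
    by (auto simp: nmult_less_iff)
qed

text \<open>Different positions disagree about the side of some hull element, and this element lies
  between them. The bounds cannot both be strict: between \<open>divisorial q\<close> and
  \<open>succ_ranger q\<close> only \<open>q\<close> itself is available.\<close>

lemma divisorial_between:
  fixes x y :: "'a::linordered_ab_group_add ranger"
  assumes "x < y"
  obtains q where "x \<le> divisorial q" "divisorial q \<le> y"
proof -
  have "\<not> y \<le> x" using assms by simp
  then consider q where "q \<in> hull_below y" "q \<notin> hull_below x"
    | q where "q \<in> hull_above x" "q \<notin> hull_above y"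
    by (auto simp: less_eq_ranger_def)
  then show thesis
    by cases (use that in \<open>auto simp: mem_below_iff mem_above_iff not_less intro: less_imp_le\<close>)
qed

lemma succ_ranger_le_iff: "succ_ranger q \<le> x \<longleftrightarrow> divisorial q < x"
  using less_succ_ranger[of q] not_between_succ_ranger[of q x] by auto

lemma not_between_pred_ranger: "\<not> (pred_ranger q < x \<and> x < divisorial q)"
proof
  assume *: "pred_ranger q < x \<and> x < divisorial q"
  then have "q \<in> hull_above x" by (simp add: mem_above_iff)
  then have "{q..} \<subseteq> hull_above x" using above_upward by blast
  moreover have "hull_below x \<subseteq> {..<q}"
    using * less_imp_le[of x "divisorial q"] by (simp add: less_eq_ranger_def)
  ultimately have "x \<le> pred_ranger q" by (simp add: less_eq_ranger_def)
  then show False using * leD by blast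
qed

lemma le_pred_ranger_iff: "x \<le> pred_ranger q \<longleftrightarrow> x < divisorial q"
  using pred_ranger_less[of q] not_between_pred_ranger[of q x] by auto

lemma divisorial_less_succ_ranger_iff: "divisorial p < succ_ranger q \<longleftrightarrow> p \<le> q"
  by (simp flip: mem_below_iff)

lemma pred_ranger_less_divisorial_iff: "pred_ranger q < divisorial p \<longleftrightarrow> q \<le> p"
  by (simp flip: mem_above_iff)

text \<open>A divisorial ranger leaves its own hull element on neither side, whereas the two sides
  of an infinitesimal ranger exhaust the hull.\<close>

lemma not_divisorial_succ_ranger: "\<not> is_divisorial (succ_ranger q)"
  and not_divisorial_pred_ranger: "\<not> is_divisorial (pred_ranger q)"
proof -
  have *: "p \<in> hull_below x \<union> hull_above x \<Longrightarrow> x \<noteq> divisorial p" for p and x :: "'a ranger"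
    by auto
  have "hull_below (succ_ranger q) \<union> hull_above (succ_ranger q) = UNIV"
    "hull_below (pred_ranger q) \<union> hull_above (pred_ranger q) = UNIV" for q :: "'a divisible_hull"
    by auto
  then show "\<not> is_divisorial (succ_ranger q)" "\<not> is_divisorial (pred_ranger q)"
    using * unfolding is_divisorial_def by blast+
qed

lemma not_unbounded_divisorial: "\<not> is_unbounded (divisorial q)"
  unfolding is_unbounded_def
  by (metis leD le_plus_infinity less_succ_ranger minus_infinity_le pred_ranger_less)

text \<open>The supremum has the union of the lower sets below it and the intersection of the upper
  sets above it. The equivalence states upper bound and leastness at once and includes the empty
  set, with supremum \<open>minus_infinity\<close>.\<close>

lemma ranger_lub_exists:
  fixes A :: "'a::linordered_ab_group_add ranger set"
  shows "\<exists>s. \<forall>u. s \<le> u \<longleftrightarrow> (\<forall>x\<in>A. x \<le> u)"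
proof -
  let ?p = "(\<Union> (hull_below ` A), \<Inter> (hull_above ` A))"
  have pos: "is_position ?p"
    unfolding is_position_def fst_conv snd_conv
  proof (intro conjI ballI allI impI)
    fix a b assume a: "a \<notin> \<Union> (hull_below ` A) \<union> \<Inter> (hull_above ` A)"
      and b: "b \<notin> \<Union> (hull_below ` A) \<union> \<Inter> (hull_above ` A)"
    obtain x where x: "x \<in> A" "a \<notin> hull_above x" using a by auto
    obtain y where y: "y \<in> A" "b \<notin> hull_above y" using b by auto
    \<comment> \<open>By linearity one member of \<open>A\<close> serves both \<open>a\<close> and
      \<open>b\<close>: the larger ranger has the smaller upper set, so both elements are missing
      from the position \<open>z\<close> and must coincide.\<close>
    define z where "z = max x y"
    have z: "z \<in> A" "hull_above z \<subseteq> hull_above x" "hull_above z \<subseteq> hull_above y"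
      using x y max.cobounded1[of x y] max.cobounded2[of y x]
      by (auto simp: z_def max_def less_eq_ranger_def)
    then show "a = b"
      using a b x y by (intro below_above_missing[of a z b]) auto
  qed (auto intro: below_downward above_upward dest: below_above_disjoint)
  have "Abs_ranger ?p \<le> u \<longleftrightarrow> (\<forall>x\<in>A. x \<le> u)" for u
    by (auto simp: less_eq_ranger_def below_Abs_ranger[OF pos] above_Abs_ranger[OF pos])
  then show ?thesis by blast
qed

section \<open>Open and closed sets\<close>

lemma ranger_base_open: "B \<in> ranger_base \<Longrightarrow> openin ranger_topology B"
  by (simp add: openin_ranger_topology union_of_inc arbitrary_def)

lemma ranger_neighbourhood:
  assumes "openin ranger_topology U" "x \<in> U"
  obtains B where "B \<in> ranger_base" "x \<in> B" "B \<subseteq> U"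
  using assms by (auto simp: openin_ranger_topology union_of_def arbitrary_def)

lemma openin_atMost_divisorial: "openin ranger_topology {..divisorial q}"
proof (rule ranger_base_open)
  have "{..divisorial q} = {minus_infinity..divisorial q}" by auto
  \<comment> \<open>This rules out the degenerate intervals that the base omits.\<close>
  moreover have "minus_infinity \<noteq> divisorial q"
    using not_unbounded_divisorial[of q] by (auto simp: is_unbounded_def)
  ultimately show "{..divisorial q} \<in> ranger_base"
    unfolding ranger_base_def is_divisorial_def is_unbounded_def by blast
qed

lemma openin_atLeast_divisorial: "openin ranger_topology {divisorial q..}"
proof (rule ranger_base_open)
  have "{divisorial q..} = {divisorial q..plus_infinity}" by auto
  moreover have "divisorial q \<noteq> minus_infinity" "divisorial q \<noteq> plus_infinity"
    using not_unbounded_divisorial[of q] by (auto simp: is_unbounded_def)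
  ultimately show "{divisorial q..} \<in> ranger_base"
    unfolding ranger_base_def is_divisorial_def is_unbounded_def by blast
qed

text \<open>The divisorial ranger found between \<open>z\<close> and \<open>y\<close> differs from
  \<open>y\<close>, so it is strictly below \<open>y\<close>; the ray is thus a union of open rays
  with divisorial endpoints.\<close>

lemma openin_lessThan:
  assumes "\<not> is_divisorial y"
  shows "openin ranger_topology {..<y}"
proof -
  have "\<exists>q. z \<le> divisorial q \<and> divisorial q < y" if "z < y" for z
    using that assms divisorial_between[OF that] unfolding is_divisorial_def
    by (metis order_le_less rangeI)
  then have "{..<y} = (\<Union>q\<in>{q. divisorial q < y}. {..divisorial q})" by force
  then show ?thesis using openin_atMost_divisorial by auto
qed

lemma openin_greaterThan:
  assumes "\<not> is_divisorial y"
  shows "openin ranger_topology {y<..}"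
proof -
  have "\<exists>q. y < divisorial q \<and> divisorial q \<le> z" if "y < z" for z
    using that assms divisorial_between[OF that] unfolding is_divisorial_def
    by (metis order_le_less rangeI)
  then have "{y<..} = (\<Union>q\<in>{q. y < divisorial q}. {divisorial q..})" by force
  then show ?thesis using openin_atLeast_divisorial by auto
qed

lemma closedin_lessThan_divisorial: "closedin ranger_topology {..<divisorial q}"
proof -
  have "UNIV - {..<divisorial q} = {divisorial q..}" by auto
  then show ?thesis using openin_atLeast_divisorial by (simp add: closedin_def)
qed

lemma closedin_greaterThan_divisorial: "closedin ranger_topology {divisorial q<..}"
proof -
  have "UNIV - {divisorial q<..} = {..divisorial q}" by auto
  then show ?thesis using openin_atMost_divisorial by (simp add: closedin_def)
qed

lemma closedin_singleton:
  assumes "\<not> is_divisorial y"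
  shows "closedin ranger_topology {y}"
proof -
  have "UNIV - {y} = {..<y} \<union> {y<..}" by auto
  then show ?thesis
    using openin_lessThan[OF assms] openin_greaterThan[OF assms]
    by (simp add: closedin_def openin_Un)
qed

text \<open>A non-divisorial point can be an endpoint of a basic interval only if it is unbounded.
  It is then the outer end of the whole order, because a left endpoint \<open>plus_infinity\<close>
  or a right endpoint \<open>minus_infinity\<close> would force a degenerate interval.\<close>

lemma base_neighbourhood_cases:
  assumes "B \<in> ranger_base" "x \<in> B"
  obtains a b where "B = {a..b}" "is_divisorial x \<or> a < x \<or> x = minus_infinity"
    "is_divisorial x \<or> x < b \<or> x = plus_infinity"
proof -
  obtain a b where B: "B = {a..b}" and ab: "is_divisorial a \<or> is_unbounded a"
    "is_divisorial b \<or> is_unbounded b" "\<not> (a = b \<and> is_unbounded a)"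
    using assms(1) by (auto simp: ranger_base_def)
  have x: "a \<le> x" "x \<le> b" using assms(2) B by auto
  have "x = minus_infinity" if "\<not> is_divisorial x" "\<not> a < x"
  proof -
    have "a = x" using x that by auto
    then show ?thesis using ab that x by (metis antisym is_unbounded_def le_plus_infinity)
  qed
  moreover have "x = plus_infinity" if "\<not> is_divisorial x" "\<not> x < b"
  proof -
    have "b = x" using x that by auto
    then show ?thesis using ab that x by (metis antisym is_unbounded_def minus_infinity_le)
  qed
  ultimately show thesis using that B by blast
qed

text \<open>A basic interval around \<open>succ_ranger q\<close> begins strictly below it, hence at
  \<open>divisorial q\<close> or earlier, since nothing lies in between. The argument for
  \<open>pred_ranger q\<close> is symmetric.\<close>

lemma divisorial_mem_of_infinitesimal_mem:
  assumes U: "openin ranger_topology U" and x: "x \<in> {succ_ranger q, pred_ranger q}" "x \<in> U"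
  shows "divisorial q \<in> U"
proof -
  obtain B where B: "B \<in> ranger_base" "x \<in> B" "B \<subseteq> U"
    using ranger_neighbourhood[OF U x(2)] .
  obtain a b where ab: "B = {a..b}" "is_divisorial x \<or> a < x \<or> x = minus_infinity"
    "is_divisorial x \<or> x < b \<or> x = plus_infinity"
    using base_neighbourhood_cases[OF B(1,2)] .
  have nd: "\<not> is_divisorial x"
    using x(1) not_divisorial_succ_ranger not_divisorial_pred_ranger by auto
  have mid: "a \<le> x" "x \<le> b" using B(2) ab(1) by auto
  have "a \<le> divisorial q \<and> divisorial q \<le> b"
  proof (cases "x = succ_ranger q")
    case True
    \<comment> \<open>Only this end is excluded: for the trivial group \<open>succ_ranger q\<close>
      is \<open>plus_infinity\<close>, but the argument moves the left bound alone.\<close>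
    then have "x \<noteq> minus_infinity"
      using less_succ_ranger[of q] by (metis leD minus_infinity_le)
    then have "a < succ_ranger q" using ab nd True by auto
    then have "a \<le> divisorial q" using succ_ranger_le_iff[of q a] by auto
    then show ?thesis using mid True less_succ_ranger[of q] by auto
  next
    case False
    then have xp: "x = pred_ranger q" using x by auto
    then have "x \<noteq> plus_infinity"
      using pred_ranger_less[of q] by (metis leD le_plus_infinity)
    then have "pred_ranger q < b" using ab nd xp by auto
    then have "divisorial q \<le> b" using le_pred_ranger_iff[of b q] by auto
    then show ?thesis using mid xp pred_ranger_less[of q] by auto
  qed
  then show ?thesis using B ab(1) by auto
qed

text \<open>Points beyond the two infinitesimal neighbours have open rays as neighbourhoods that
  miss \<open>divisorial q\<close>; the neighbours themselves cannot be separated from it.\<close>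

lemma closure_of_divisorial:
  "ranger_topology closure_of {divisorial q} = {divisorial q, succ_ranger q, pred_ranger q}"
proof (intro equalityI subsetI)
  fix x assume x: "x \<in> ranger_topology closure_of {divisorial q}"
  have "\<not> succ_ranger q < x"
  proof
    assume "succ_ranger q < x"
    then have "divisorial q \<in> {succ_ranger q<..}"
      using x openin_greaterThan[OF not_divisorial_succ_ranger[of q]] unfolding in_closure_of
      by (metis greaterThan_iff singletonD)
    then show False using less_succ_ranger[of q] by simp
  qed
  moreover have "\<not> x < pred_ranger q"
  proof
    assume "x < pred_ranger q"
    then have "divisorial q \<in> {..<pred_ranger q}"
      using x openin_lessThan[OF not_divisorial_pred_ranger[of q]] unfolding in_closure_of
      by (metis lessThan_iff singletonD)
    then show False using pred_ranger_less[of q] by simp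
  qed
  ultimately show "x \<in> {divisorial q, succ_ranger q, pred_ranger q}"
    using not_between_succ_ranger[of q x] not_between_pred_ranger[of q x] by auto
next
  fix x assume "x \<in> {divisorial q, succ_ranger q, pred_ranger q}"
  then show "x \<in> ranger_topology closure_of {divisorial q}"
    using divisorial_mem_of_infinitesimal_mem[of _ x q] by (auto simp: in_closure_of)
qed

section \<open>Compactness and connectedness\<close>

text \<open>The supremum \<open>s\<close> of the points reached from \<open>x\<close> is shown to be
  reached and to equal \<open>y\<close>. The delicate case is a divisorial \<open>s\<close>, for
  which the singleton of \<open>s\<close> is open and a neighbourhood of \<open>s\<close> leads
  nowhere; there the infinitesimal neighbours of \<open>s\<close> do the work.\<close>

lemma ranger_interval_induct:
  fixes P :: "'a::linordered_ab_group_add ranger \<Rightarrow> 'a ranger \<Rightarrow> bool"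
  assumes xy: "x \<le> y"
    and trans: "\<And>u v w. u \<le> v \<Longrightarrow> v \<le> w \<Longrightarrow> P u v \<Longrightarrow> P v w \<Longrightarrow> P u w"
    and loc: "\<And>z. z \<in> {x..y} \<Longrightarrow> \<exists>U. openin ranger_topology U \<and> z \<in> U \<and>
      (\<forall>u\<in>U \<inter> {x..y}. \<forall>v\<in>U \<inter> {x..y}. u \<le> v \<longrightarrow> P u v)"
  shows "P x y"
proof -
  define A where "A = {z \<in> {x..y}. P x z}"
  obtain s where s: "\<And>u. s \<le> u \<longleftrightarrow> (\<forall>z\<in>A. z \<le> u)"
    using ranger_lub_exists[of A] by auto
  have upper: "z \<le> s" if "z \<in> A" for z using s that by blast
  \<comment> \<open>\<open>P x x\<close> is the local hypothesis at \<open>x\<close> with both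
    points equal to \<open>x\<close>.\<close>
  have xA: "x \<in> A" using loc[of x] xy by (auto simp: A_def)
  have sxy: "s \<in> {x..y}" using upper[OF xA] s[of y] by (auto simp: A_def)
  obtain U where U: "openin ranger_topology U" "s \<in> U"
    "\<And>u v. u \<in> U \<inter> {x..y} \<Longrightarrow> v \<in> U \<inter> {x..y} \<Longrightarrow> u \<le> v \<Longrightarrow> P u v"
    using loc[OF sxy] by blast
  obtain B where B: "B \<in> ranger_base" "s \<in> B" "B \<subseteq> U"
    using ranger_neighbourhood[OF U(1,2)] .
  obtain a b where ab: "B = {a..b}" "is_divisorial s \<or> a < s \<or> s = minus_infinity"
    "is_divisorial s \<or> s < b \<or> s = plus_infinity"
    using base_neighbourhood_cases[OF B(1,2)] .
  \<comment> \<open>Since \<open>B\<close> lies in \<open>U\<close>, any point of \<open>A\<close>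
    in \<open>B\<close> can be joined to every later point of \<open>B\<close> up to
    \<open>y\<close>.\<close>
  have extend: "t \<in> A" if "z \<in> A" "z \<in> {a..b}" "z \<le> t" "t \<in> {a..b}" "t \<le> y" for z t
  proof -
    have z: "x \<le> z" "z \<le> y" "P x z" using that(1) by (auto simp: A_def)
    then have t: "t \<in> {x..y}" using that by auto
    have "P z t" by (rule U(3)) (use that z t B(3) ab(1) in auto)
    with z t show ?thesis using trans[of x z t] that(3) by (simp add: A_def)
  qed
  have sA: "s \<in> A"
  proof (rule ccontr)
    assume sA: "s \<notin> A"
    \<comment> \<open>A divisorial supremum is attained: otherwise its immediate predecessor would
      be a smaller upper bound.\<close>
    have "\<not> is_divisorial s"
    proof
      assume "is_divisorial s"
      then obtain q where q: "s = divisorial q" by (auto simp: is_divisorial_def)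
      have "z < s" if "z \<in> A" for z using that sA upper[OF that] by (metis order_le_less)
      then have "s \<le> pred_ranger q" using s[of "pred_ranger q"] q le_pred_ranger_iff by blast
      then show False using q pred_ranger_less[of q] by auto
    qed
    moreover have "s \<noteq> minus_infinity"
      using upper[OF xA] xA sA by (metis antisym minus_infinity_le)
    \<comment> \<open>Now \<open>a\<close> is below the supremum, so some point of \<open>A\<close>
      lies in \<open>B\<close>, and one step inside \<open>B\<close> reaches
      \<open>s\<close>.\<close>
    ultimately have "\<not> s \<le> a" using ab by auto
    then obtain z where z: "z \<in> A" "a < z" using s[of a] by (auto simp: not_le)
    have "s \<in> A"
      by (rule extend[of z]) (use z upper[OF z(1)] sxy B(2) ab(1) in auto)
    then show False using sA by simp
  qed
  have "s = y"
  proof (rule ccontr)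
    assume "s \<noteq> y"
    then have sy: "s < y" using sxy by auto
    show False
    proof (cases "is_divisorial s")
      case True
      then obtain q where q: "s = divisorial q" by (auto simp: is_divisorial_def)
      \<comment> \<open>The step to the right uses a neighbourhood of \<open>succ_ranger q\<close>,
        which automatically contains \<open>s\<close>.\<close>
      have le: "succ_ranger q \<le> y" using sy q by (simp add: succ_ranger_le_iff)
      have less: "s < succ_ranger q" using q less_succ_ranger by simp
      have mem: "succ_ranger q \<in> {x..y}" using sxy less le by auto
      obtain V where V: "openin ranger_topology V" "succ_ranger q \<in> V"
        "\<And>u v. u \<in> V \<inter> {x..y} \<Longrightarrow> v \<in> V \<inter> {x..y} \<Longrightarrow> u \<le> v \<Longrightarrow> P u v"
        using loc[OF mem] by blast
      have "s \<in> V" using divisorial_mem_of_infinitesimal_mem[OF V(1), of "succ_ranger q" q] V(2) q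
        by simp
      then have "P s (succ_ranger q)" using V sxy mem less by auto
      then have "succ_ranger q \<in> A"
        using sA mem less sxy trans[of x s "succ_ranger q"] by (auto simp: A_def)
      then show False using upper[of "succ_ranger q"] less by simp
    next
      case False
      \<comment> \<open>Here \<open>B\<close> extends strictly to the right of \<open>s\<close>, so
        \<open>min b y\<close> is a reached point beyond the supremum.\<close>
      have "s \<noteq> plus_infinity" using sy leD[OF le_plus_infinity[of y]] by auto
      then have "s < b" using ab False by auto
      then have less: "s < min b y" using sy by simp
      have ab_s: "a \<le> s" "s \<le> b" using B(2) ab(1) by simp_all
      have "min b y \<in> A"
      proof (rule extend[OF sA])
        show "min b y \<in> {a..b}"
          using ab_s(1) less by (meson atLeastAtMost_iff less_imp_le min.cobounded1 order_trans)
      qed (use ab_s less in auto)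
      then show False using leD[OF upper[of "min b y"]] less by simp
    qed
  qed
  then show ?thesis using sA by (simp add: A_def)
qed

text \<open>Finite subcovers of adjacent intervals combine, so real induction applies to the
  interval from \<open>minus_infinity\<close> to \<open>plus_infinity\<close>, which is the whole
  space.\<close>

lemma compact_space_ranger_topology: "compact_space ranger_topology"
  unfolding compact_space_alt topspace_ranger_topology
proof (intro allI impI, elim conjE)
  fix \<U> :: "'a ranger set set"
  assume op: "\<forall>U\<in>\<U>. openin ranger_topology U" and cover: "UNIV \<subseteq> \<Union> \<U>"
  define P where "P = (\<lambda>u v. \<exists>\<F>. finite \<F> \<and> \<F> \<subseteq> \<U> \<and> {u..v} \<subseteq> \<Union> \<F>)"
  have "P minus_infinity plus_infinity"
  proof (rule ranger_interval_induct)
    fix u v w :: "'a ranger"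
    assume "u \<le> v" "v \<le> w" "P u v" "P v w"
    then obtain \<F> \<G> where "finite \<F>" "\<F> \<subseteq> \<U>" "{u..v} \<subseteq> \<Union> \<F>"
      "finite \<G>" "\<G> \<subseteq> \<U>" "{v..w} \<subseteq> \<Union> \<G>"
      by (auto simp: P_def)
    moreover have "{u..w} \<subseteq> {u..v} \<union> {v..w}" by auto
    ultimately show "P u w"
      unfolding P_def by (intro exI[of _ "\<F> \<union> \<G>"]) auto
  next
    fix z :: "'a ranger"
    obtain U where U: "U \<in> \<U>" "z \<in> U" using cover by auto
    obtain B where B: "B \<in> ranger_base" "z \<in> B" "B \<subseteq> U"
      using ranger_neighbourhood[of U z] U op by blast
    have "P u v" if "u \<in> B" "v \<in> B" for u v
    proof -
      \<comment> \<open>Basic sets are convex, so a single member of the cover suffices near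
        \<open>z\<close>.\<close>
      have "{u..v} \<subseteq> B" using B(1) that by (auto simp: ranger_base_def)
      then show ?thesis unfolding P_def using U B by (intro exI[of _ "{U}"]) auto
    qed
    then show "\<exists>U. openin ranger_topology U \<and> z \<in> U \<and> (\<forall>u\<in>U \<inter> {minus_infinity..plus_infinity}.
        \<forall>v\<in>U \<inter> {minus_infinity..plus_infinity}. u \<le> v \<longrightarrow> P u v)"
      using B ranger_base_open by blast
  qed simp
  then show "\<exists>\<F>. finite \<F> \<and> \<F> \<subseteq> \<U> \<and> UNIV \<subseteq> \<Union> \<F>"
    unfolding P_def by (metis UNIV_I atLeastAtMost_iff le_plus_infinity minus_infinity_le subset_eq)
qed

text \<open>For a separation of \<open>S\<close>, membership in \<open>E1\<close> is locally
  constant on an interval inside \<open>S\<close>, so real induction carries it from one endpoint to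
  the other.\<close>

lemma connectedin_convex:
  fixes S :: "'a::linordered_ab_group_add ranger set"
  assumes convex: "\<And>x y. x \<in> S \<Longrightarrow> y \<in> S \<Longrightarrow> {x..y} \<subseteq> S"
  shows "connectedin ranger_topology S"
proof -
  have False if E: "openin ranger_topology E1" "openin ranger_topology E2" "S \<subseteq> E1 \<union> E2"
    "E1 \<inter> E2 \<inter> S = {}" and x: "x \<in> E1 \<inter> S" and y: "y \<in> E2 \<inter> S" and xy: "x \<le> y"
    for E1 E2 x y
  proof -
    have sub: "{x..y} \<subseteq> S" using convex x y by blast
    have "x \<in> E1 \<longleftrightarrow> y \<in> E1"
    proof (rule ranger_interval_induct[OF xy])
      fix z assume "z \<in> {x..y}"
      then have "z \<in> E1 \<or> z \<in> E2" using sub E by auto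
      then show "\<exists>U. openin ranger_topology U \<and> z \<in> U \<and>
          (\<forall>u\<in>U \<inter> {x..y}. \<forall>v\<in>U \<inter> {x..y}. u \<le> v \<longrightarrow> (u \<in> E1) = (v \<in> E1))"
        using E sub by (elim disjE; blast)
    qed simp
    then show False using x y E by auto
  qed
  note * = this
  show ?thesis
    unfolding connectedin
  proof (intro conjI notI)
    assume "\<exists>E1 E2. openin ranger_topology E1 \<and> openin ranger_topology E2 \<and> S \<subseteq> E1 \<union> E2 \<and>
      E1 \<inter> E2 \<inter> S = {} \<and> E1 \<inter> S \<noteq> {} \<and> E2 \<inter> S \<noteq> {}"
    then obtain E1 E2 x y where E: "openin ranger_topology E1" "openin ranger_topology E2"
      "S \<subseteq> E1 \<union> E2" "E1 \<inter> E2 \<inter> S = {}" and x: "x \<in> E1 \<inter> S" and y: "y \<in> E2 \<inter> S"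
      by blast
    show False
    proof (cases "x \<le> y")
      case True
      then show False using *[OF E x y] by simp
    next
      case False
      \<comment> \<open>The induction runs upwards, so the two sides of the separation exchange
        roles.\<close>
      then have "y \<le> x" by simp
      moreover have "S \<subseteq> E2 \<union> E1" "E2 \<inter> E1 \<inter> S = {}" using E(3,4) by auto
      ultimately show False using *[OF E(2,1) _ _ y x] by simp
    qed
  qed simp
qed

text \<open>Both sets are clopen. A component meeting a connected clopen set contains it by
  maximality and is contained in it by connectedness.\<close>

lemma connected_components_of_two_open:
  assumes open_AB: "openin X A" "openin X B" and disj: "A \<inter> B = {}" and cover: "A \<union> B = topspace X"
    and conn: "connectedin X A" "connectedin X B" and ne: "A \<noteq> {}" "B \<noteq> {}"
  shows "connected_components_of X = {A, B}"
proof -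
  have "topspace X - A = B" "topspace X - B = A" using disj cover by auto
  then have closed_AB: "closedin X A" "closedin X B"
    using open_AB openin_subset[of X] by (auto simp: closedin_def)
  have eq: "C = D" if C: "C \<in> connected_components_of X" and D: "openin X D" "closedin X D"
    "connectedin X D" "C \<inter> D \<noteq> {}" for C D
  proof
    show "D \<subseteq> C" using connected_components_of_maximal[OF C D(3)] D(4) by (simp add: disjnt_def)
    show "C \<subseteq> D"
      using connectedin_clopen_cases[OF connectedin_connected_components_of[OF C] D(2,1)] D(4)
      by (auto simp: disjnt_def)
  qed
  have "C \<in> {A, B}" if C: "C \<in> connected_components_of X" for C
  proof -
    have "C \<inter> A \<noteq> {} \<or> C \<inter> B \<noteq> {}"
      using nonempty_connected_components_of[OF C] connected_components_of_subset[OF C] cover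
      by blast
    then show ?thesis using eq[OF C] open_AB closed_AB conn by auto
  qed
  moreover have "D \<in> connected_components_of X" if D: "openin X D" "closedin X D"
    "connectedin X D" "D \<noteq> {}" for D
  proof -
    obtain x where "x \<in> D" using D by auto
    then have "x \<in> \<Union> (connected_components_of X)"
      using D openin_subset Union_connected_components_of by fastforce
    then obtain C where "C \<in> connected_components_of X" "x \<in> C" by blast
    then show ?thesis using eq[OF _ D(1-3), of C] \<open>x \<in> D\<close> by auto
  qed
  ultimately show ?thesis using open_AB closed_AB conn ne by blast
qed

text \<open>The rays at \<open>x\<close> are closed in the whole space for divisorial
  \<open>x\<close> and open otherwise. In the punctured space they are complementary, so either way
  both are open there.\<close>

lemma connected_components_of_punctured:
  assumes "\<not> is_unbounded x"
  shows "connected_components_of (subtopology ranger_topology (UNIV - {x})) = {{..<x}, {x<..}}"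
proof (rule connected_components_of_two_open)
  have L: "{..<x} = (UNIV - {x}) - {x<..}" and G: "{x<..} = (UNIV - {x}) - {..<x}"
    by auto
  have "openin (subtopology ranger_topology (UNIV - {x})) {..<x} \<and>
    openin (subtopology ranger_topology (UNIV - {x})) {x<..}"
  proof (cases "is_divisorial x")
    case True
    then have "closedin ranger_topology {..<x}" "closedin ranger_topology {x<..}"
      using closedin_lessThan_divisorial closedin_greaterThan_divisorial
      by (auto simp: is_divisorial_def)
    then have "closedin (subtopology ranger_topology (UNIV - {x})) {..<x}"
      "closedin (subtopology ranger_topology (UNIV - {x})) {x<..}"
      by (auto intro!: closedin_subset_topspace)
    then show ?thesis
      unfolding openin_closedin_eq topspace_subtopology topspace_ranger_topology Int_UNIV_left Int_UNIV_right
        L[symmetric] G[symmetric]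
      by auto
  next
    case False
    then show ?thesis
      by (auto intro!: subset_openin_subtopology openin_lessThan openin_greaterThan)
  qed
  then show "openin (subtopology ranger_topology (UNIV - {x})) {..<x}"
    "openin (subtopology ranger_topology (UNIV - {x})) {x<..}"
    by auto
  have "minus_infinity < x" "x < plus_infinity"
    using assms unfolding is_unbounded_def by (metis minus_infinity_le le_plus_infinity order_le_less)+
  then show "{..<x} \<noteq> {}" "{x<..} \<noteq> {}" by auto
qed (auto simp: connectedin_subtopology intro!: connectedin_convex)

section \<open>The maximal Hausdorff quotient\<close>

text \<open>Strict inequality of blocks. Both bounds are closed, so the sets of all \<open>y\<close> separated from
  a fixed \<open>x\<close> are unions of basic intervals.\<close>

definition separated :: "'a::linordered_ab_group_add ranger \<Rightarrow> 'a ranger \<Rightarrow> bool" where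
  "separated x y \<longleftrightarrow> (\<exists>p q. p < q \<and> x \<le> divisorial p \<and> divisorial q \<le> y)"

lemma separated_imp_less: "separated x y \<Longrightarrow> x < y"
  unfolding separated_def
  by (metis divisorial_less_iff order_le_less_trans order_less_le_trans)

lemma separated_asym: "separated x y \<Longrightarrow> \<not> separated y x"
  using separated_imp_less less_asym by blast

lemma separated_mono: "separated x y \<Longrightarrow> x' \<le> x \<Longrightarrow> y \<le> y' \<Longrightarrow> separated x' y'"
  unfolding separated_def by (meson order_trans)

text \<open>The midpoint \<open>m\<close> of the two witnesses decides: \<open>y\<close> lies on one
  side of \<open>divisorial m\<close>. Contraposed, this is transitivity of not being
  separated.\<close>

lemma separated_cotrans:
  assumes "separated x z"
  shows "separated x y \<or> separated y z"
proof -
  obtain p q where pq: "p < q" "x \<le> divisorial p" "divisorial q \<le> z"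
    using assms by (auto simp: separated_def)
  obtain m where "p < m" "m < q" using divisible_hull_dense[OF pq(1)] by auto
  then show ?thesis
    unfolding separated_def using pq by (meson linear)
qed

text \<open>The point in between supplies the disjoint open rays for the Hausdorff property of the
  block order.\<close>

lemma separated_dense:
  assumes "separated x y"
  obtains z where "separated x z" "separated z y"
proof -
  obtain p q where pq: "p < q" "x \<le> divisorial p" "divisorial q \<le> y"
    using assms by (auto simp: separated_def)
  obtain m where m: "p < m" "m < q" using divisible_hull_dense[OF pq(1)] by auto
  then have "separated x (divisorial m)" "separated (divisorial m) y"
    unfolding separated_def using pq by blast+
  then show thesis using that by blast
qed

lemma openin_separated_right: "openin ranger_topology {y. separated x y}"
proof -
  have "{y. separated x y} = (\<Union>q\<in>{q. \<exists>p. p < q \<and> x \<le> divisorial p}. {divisorial q..})"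
    by (auto simp: separated_def)
  then show ?thesis using openin_atLeast_divisorial by auto
qed

lemma openin_separated_left: "openin ranger_topology {y. separated y x}"
proof -
  have "{y. separated y x} = (\<Union>p\<in>{p. \<exists>q. p < q \<and> divisorial q \<le> x}. {..divisorial p})"
    by (auto simp: separated_def)
  then show ?thesis using openin_atMost_divisorial by auto
qed

section \<open>Identification of closures as non-separation\<close>

lemma equiv_not_separated: "equiv UNIV {(x, y). \<not> separated x y \<and> \<not> separated y x}"
proof (rule equivI)
  show "refl {(x, y). \<not> separated x y \<and> \<not> separated y x}"
    using separated_imp_less by (fastforce simp: refl_on_def)
  show "trans {(x, y). \<not> separated x y \<and> \<not> separated y x}"
    unfolding trans_def using separated_cotrans by blast
qed (auto simp: sym_def)

lemma equiv_rtrancl_eq: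
  assumes "equiv UNIV E"
  shows "E\<^sup>* = E"
proof -
  have "Id \<subseteq> E" "trans E" using assms by (auto simp: equiv_def refl_on_def)
  then show ?thesis by (auto simp: rtrancl_trancl_reflcl trancl_id)
qed

text \<open>The closure lies between \<open>pred_ranger q\<close> and \<open>succ_ranger q\<close>,
  where \<open>divisorial q\<close> is the only divisorial ranger, while separation requires two of
  them.\<close>

lemma closure_of_divisorial_not_separated:
  assumes "x \<in> ranger_topology closure_of {divisorial q}" "y \<in> ranger_topology closure_of {divisorial q}"
  shows "\<not> separated x y"
proof
  have "pred_ranger q \<le> x" "y \<le> succ_ranger q"
    using assms pred_ranger_less[of q] less_succ_ranger[of q]
    by (auto simp: closure_of_divisorial)
  moreover assume "separated x y"
  ultimately obtain p r where "p < r" "pred_ranger q \<le> divisorial p" "divisorial r \<le> succ_ranger q"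
    unfolding separated_def by (meson order_trans)
  then show False
    using not_divisorial_pred_ranger[of q] not_divisorial_succ_ranger[of q]
    by (metis divisorial_less_succ_ranger_iff is_divisorial_def leD order_le_less order_trans
        pred_ranger_less_divisorial_iff rangeI)
qed

text \<open>Some \<open>divisorial q\<close> lies between \<open>x\<close> and \<open>y\<close>. If
  \<open>y\<close> went beyond \<open>succ_ranger q\<close> or \<open>x\<close> below
  \<open>pred_ranger q\<close>, a second divisorial ranger would fit in and separate them.\<close>

lemma closure_of_divisorial_of_not_separated:
  assumes "x < y" "\<not> separated x y"
  obtains q where "x \<in> ranger_topology closure_of {divisorial q}"
    "y \<in> ranger_topology closure_of {divisorial q}"
proof -
  obtain q where q: "x \<le> divisorial q" "divisorial q \<le> y"
    using divisorial_between[OF assms(1)] .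
  have "\<not> succ_ranger q < y"
  proof
    assume "succ_ranger q < y"
    then obtain r where r: "succ_ranger q \<le> divisorial r" "divisorial r \<le> y"
      using divisorial_between by blast
    then have "q < r" by (simp add: succ_ranger_le_iff divisorial_less_iff)
    then show False using assms(2) q r by (auto simp: separated_def)
  qed
  moreover have "\<not> x < pred_ranger q"
  proof
    assume "x < pred_ranger q"
    then obtain r where r: "x \<le> divisorial r" "divisorial r \<le> pred_ranger q"
      using divisorial_between by blast
    then have "r < q" by (simp add: le_pred_ranger_iff divisorial_less_iff)
    then show False using assms(2) q r by (auto simp: separated_def)
  qed
  ultimately have "x \<in> {divisorial q, pred_ranger q}" "y \<in> {divisorial q, succ_ranger q}"
    using q le_pred_ranger_iff[of x q] succ_ranger_le_iff[of q y] by auto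
  then show thesis by (intro that[of q]) (auto simp: closure_of_divisorial)
qed

text \<open>Non-separation is an equivalence relation containing the generators, and any two
  different non-separated points already share one closure. The reflexive transitive closure
  therefore adds only the diagonal.\<close>

lemma closure_identification_eq:
  "closure_identification = {(x, y). \<not> separated x y \<and> \<not> separated y x}" (is "_ = ?D")
proof
  let ?G = "\<Union>q. (ranger_topology closure_of {divisorial q}) \<times> (ranger_topology closure_of {divisorial q})"
  have "?G \<subseteq> ?D" using closure_of_divisorial_not_separated by blast
  then have "?G\<^sup>* \<subseteq> ?D\<^sup>*" by (rule rtrancl_mono)
  also have "?D\<^sup>* = ?D"
    by (rule equiv_rtrancl_eq[OF equiv_not_separated])
  finally show "closure_identification \<subseteq> ?D" unfolding closure_identification_def .
  have gen: "(x, y) \<in> closure_identification \<and> (y, x) \<in> closure_identification"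
    if xy: "x < y" "\<not> separated x y" for x y
  proof -
    obtain q where "x \<in> ranger_topology closure_of {divisorial q}"
      "y \<in> ranger_topology closure_of {divisorial q}"
      using closure_of_divisorial_of_not_separated[OF xy] .
    then have "(x, y) \<in> ?G" "(y, x) \<in> ?G" by blast+
    then show ?thesis unfolding closure_identification_def by (simp add: r_into_rtrancl)
  qed
  show "?D \<subseteq> closure_identification"
  proof clarify
    fix x y :: "'a ranger" assume "\<not> separated x y" "\<not> separated y x"
    then show "(x, y) \<in> closure_identification"
    proof (cases x y rule: linorder_cases)
      case equal
      then show ?thesis by (simp add: closure_identification_def)
    qed (use gen in blast)+
  qed
qed

lemma equiv_closure_identification: "equiv UNIV closure_identification"
  unfolding closure_identification_eq by (rule equiv_not_separated)

text \<open>The quotient map is continuous, so it sends the closure of a point into the closure of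
  its image; points of a Hausdorff space are closed, so each closure collapses.\<close>

lemma closure_identification_subset_max_hausdorff_rel:
  "closure_identification \<subseteq> max_hausdorff_rel ranger_topology"
proof -
  let ?M = "max_hausdorff_rel (ranger_topology :: 'a ranger topology)"
  have E: "equiv UNIV ?M"
    using equiv_max_hausdorff_rel[of "ranger_topology :: 'a ranger topology"] by simp
  have q: "continuous_map ranger_topology (max_hausdorff_quotient ranger_topology) (\<lambda>x. ?M `` {x})"
    unfolding max_hausdorff_quotient_def
    by (intro quotient_imp_continuous_map quotient_map_quotient_topology equiv_max_hausdorff_rel)
  have "?M `` {x} = ?M `` {divisorial q}"
    if "x \<in> ranger_topology closure_of {divisorial q}" for x q
  proof -
    have "?M `` {x} \<in> max_hausdorff_quotient ranger_topology closure_of {?M `` {divisorial q}}"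
      using continuous_map_image_closure_subset[OF q, of "{divisorial q}"] that
      by (simp add: image_subset_iff)
    moreover have "closedin (max_hausdorff_quotient ranger_topology) {?M `` {divisorial q}}"
    proof -
      have "?M `` {divisorial q} \<in> topspace (max_hausdorff_quotient ranger_topology)"
        using continuous_map_image_subset_topspace[OF q] unfolding topspace_ranger_topology by blast
      then show ?thesis
        using Hausdorff_imp_t1_space[OF Hausdorff_max_hausdorff_quotient, of ranger_topology]
        unfolding t1_space_closedin_singleton by blast
    qed
    ultimately show ?thesis by (simp add: closure_of_closedin)
  qed
  then have "(x, y) \<in> ?M" if "x \<in> ranger_topology closure_of {divisorial q}"
    "y \<in> ranger_topology closure_of {divisorial q}" for x y q
    using that by (metis UNIV_I eq_equiv_class[OF _ E])
  then have "(\<Union>q. (ranger_topology closure_of {divisorial q}) \<times>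
      (ranger_topology closure_of {divisorial q})) \<subseteq> ?M"
    by auto
  then have "closure_identification \<subseteq> ?M\<^sup>*"
    unfolding closure_identification_def by (rule rtrancl_mono)
  also have "?M\<^sup>* = ?M"
    by (rule equiv_rtrancl_eq[OF E])
  finally show ?thesis .
qed

section \<open>The ordered set of blocks\<close>

context
begin

private abbreviation cls :: "'a::linordered_ab_group_add ranger \<Rightarrow> 'a ranger set" where
  "cls x \<equiv> closure_identification `` {x}"

private abbreviation blocks :: "'a::linordered_ab_group_add ranger set set" where
  "blocks \<equiv> UNIV // closure_identification"

text \<open>Expresses the order of blocks through arbitrary representatives, so that its laws reduce
  to those of \<open>separated\<close>.\<close>

lemma quotient_order_iff:
  "(cls x, cls y) \<in> quotient_order blocks \<longleftrightarrow> \<not> separated y x"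
proof -
  have "(\<exists>a\<in>cls x. \<exists>b\<in>cls y. a \<le> b) \<longleftrightarrow> \<not> separated y x"
  proof
    assume "\<exists>a\<in>cls x. \<exists>b\<in>cls y. a \<le> b"
    then obtain a b where ab: "\<not> separated a x" "\<not> separated x a" "\<not> separated y b"
      "\<not> separated b y" "a \<le> b"
      by (auto simp: closure_identification_eq)
    show "\<not> separated y x"
    proof
      assume "separated y x"
      \<comment> \<open>Cotransitivity twice: \<open>y\<close> may be replaced by the equivalent
        \<open>b\<close>, and \<open>x\<close> by the equivalent \<open>a\<close>.\<close>
      then have "separated b a" using ab separated_cotrans by blast
      then show False using separated_imp_less ab(5) leD by blast
    qed
  next
    assume n: "\<not> separated y x"
    show "\<exists>a\<in>cls x. \<exists>b\<in>cls y. a \<le> b"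
    proof (cases "separated x y")
      case True
      then show ?thesis
        using equiv_class_self[OF equiv_closure_identification] separated_imp_less less_imp_le
        by (metis UNIV_I)
    next
      case False
      then have "(x, y) \<in> closure_identification" using n by (simp add: closure_identification_eq)
      then have "cls x = cls y" by (rule equiv_class_eq[OF equiv_closure_identification])
      then show ?thesis
        using equiv_class_self[OF equiv_closure_identification] by (metis UNIV_I order_refl)
    qed
  qed
  then show ?thesis by (simp add: quotient_order_def quotientI)
qed

lemma class_eq_iff: "cls x = cls y \<longleftrightarrow> \<not> separated x y \<and> \<not> separated y x"
  using eq_equiv_class_iff[OF equiv_closure_identification, of x y]
  by (simp add: closure_identification_eq)

lemma blocks_cases:
  assumes "A \<in> blocks"
  obtains x where "A = cls x"
  using assms by (rule quotientE)

lemma linear_order_on_blocks: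
  "linear_order_on (blocks :: 'a::linordered_ab_group_add ranger set set) (quotient_order blocks)"
  (is "linear_order_on ?B ?r")
  unfolding linear_order_on_def partial_order_on_def preorder_on_def
proof (intro conjI)
  show "?r \<subseteq> ?B \<times> ?B" by (auto simp: quotient_order_def)
  show "refl_on ?B (?r)"
    by (auto simp: refl_on_def quotient_order_iff elim!: blocks_cases dest: separated_imp_less)
  show "trans (?r)"
  proof (rule transI)
    fix A B C :: "'a ranger set"
    assume *: "(A, B) \<in> ?r" "(B, C) \<in> ?r"
    then have "A \<in> ?B" "B \<in> ?B" "C \<in> ?B" unfolding quotient_order_def by blast+
    then obtain x y z where "A = cls x" "B = cls y" "C = cls z" by (elim blocks_cases) blast
    then show "(A, C) \<in> ?r"
      using * separated_cotrans[of z x y] by (auto simp: quotient_order_iff)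
  qed
  show "antisym (?r)"
  proof (rule antisymI)
    fix A B :: "'a ranger set"
    assume *: "(A, B) \<in> ?r" "(B, A) \<in> ?r"
    then have "A \<in> ?B" "B \<in> ?B" unfolding quotient_order_def by blast+
    then obtain x y where "A = cls x" "B = cls y" by (elim blocks_cases) blast
    then show "A = B" using * by (simp add: quotient_order_iff class_eq_iff)
  qed
  show "total_on ?B (?r)"
  proof (rule total_onI)
    fix A B :: "'a ranger set"
    assume "A \<in> ?B" "B \<in> ?B"
    then obtain x y where "A = cls x" "B = cls y" by (elim blocks_cases) blast
    then show "(A, B) \<in> ?r \<or> (B, A) \<in> ?r"
      using separated_imp_less[of x y] separated_imp_less[of y x] by (auto simp: quotient_order_iff)
  qed
qed

text \<open>Rewrites the strict rays of the block order as sets of blocks cut out by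
  \<open>separated\<close>, which can be compared with open sets of rangers.\<close>

lemma order_topology_on_blocks:
  "order_topology_on (blocks :: 'a::linordered_ab_group_add ranger set set) (quotient_order blocks) = topology_generated_by
     ({blocks} \<union> range (\<lambda>x. {A \<in> blocks. \<exists>y\<in>A. separated x y})
       \<union> range (\<lambda>x. {A \<in> blocks. \<exists>y\<in>A. separated y x}))"
proof -
  have class_mem: "y \<in> cls y" for y :: "'a ranger"
    using equiv_class_self[OF equiv_closure_identification] by blast
  \<comment> \<open>Being separated from \<open>x\<close> depends only on the block, by
    cotransitivity.\<close>
  have sep: "(\<exists>z\<in>cls y. separated x z) \<longleftrightarrow> separated x y"
    "(\<exists>z\<in>cls y. separated z x) \<longleftrightarrow> separated y x" for x y :: "'a ranger"
    using class_mem separated_cotrans by (fastforce simp: closure_identification_eq)+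
  have image_blocks: "f ` blocks = range (\<lambda>x. f (cls x))" for f :: "'a ranger set \<Rightarrow> 'a ranger set set"
    by (auto simp: quotient_def)
  have right: "{A \<in> blocks. (cls x, A) \<in> quotient_order blocks \<and> A \<noteq> cls x} =
      {A \<in> blocks. \<exists>y\<in>A. separated x y}" for x :: "'a ranger"
    by (rule Collect_cong, rule conj_cong[OF refl], elim blocks_cases)
      (use separated_asym in \<open>auto simp only: quotient_order_iff class_eq_iff sep\<close>)
  have left: "{A \<in> blocks. (A, cls x) \<in> quotient_order blocks \<and> A \<noteq> cls x} =
      {A \<in> blocks. \<exists>y\<in>A. separated y x}" for x :: "'a ranger"
    by (rule Collect_cong, rule conj_cong[OF refl], elim blocks_cases)
      (use separated_asym in \<open>auto simp only: quotient_order_iff class_eq_iff sep\<close>)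
  show ?thesis
    unfolding order_topology_on_def image_blocks right left by (rule refl)
qed

text \<open>Two different blocks have separated representatives; the rays below and above an
  intermediate point \<open>z\<close> are disjoint neighbourhoods.\<close>

lemma Hausdorff_order_topology_on_blocks:
  "Hausdorff_space (order_topology_on (blocks :: 'a::linordered_ab_group_add ranger set set)
    (quotient_order blocks))" (is "Hausdorff_space ?O")
proof -
  let ?right = "\<lambda>x. {A \<in> blocks. \<exists>y\<in>A. separated (x :: 'a ranger) y}"
  let ?left = "\<lambda>x. {A \<in> blocks. \<exists>y\<in>A. separated y (x :: 'a ranger)}"
  have open_O: "openin ?O (?right x)" "openin ?O (?left x)" for x
    unfolding order_topology_on_blocks by (rule topology_generated_by_Basis; blast)+
  have topspace_O: "topspace ?O = blocks"
    unfolding order_topology_on_blocks by auto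
  have sep: "\<exists>U V. openin ?O U \<and> openin ?O V \<and> cls x \<in> U \<and> cls y \<in> V \<and> disjnt U V"
    if xy: "separated x y" for x y
  proof -
    obtain z where z: "separated x z" "separated z y" using separated_dense[OF xy] .
    have self: "w \<in> cls w" for w :: "'a ranger"
      using equiv_class_self[OF equiv_closure_identification] by blast
    have "cls x \<in> ?left z" "cls y \<in> ?right z" using z self by (blast intro: quotientI)+
    moreover have "disjnt (?left z) (?right z)"
    proof (rule ccontr)
      assume "\<not> disjnt (?left z) (?right z)"
      then obtain A a b where A: "A \<in> blocks" "a \<in> A" "b \<in> A" "separated a z" "separated z b"
        by (auto simp: disjnt_iff)
      then have "(a, b) \<in> closure_identification"
        using quotient_eq_iff[OF equiv_closure_identification, of A A a b] by blast
      \<comment> \<open>\<open>separated z b\<close> gives \<open>z < b\<close>, and monotonicity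
        transfers \<open>separated a z\<close> to \<open>b\<close>; but \<open>a\<close> and
        \<open>b\<close> share a block.\<close>
      moreover have "separated a b" using A(4,5) separated_mono separated_imp_less less_imp_le by blast
      ultimately show False by (simp add: closure_identification_eq)
    qed
    ultimately show ?thesis using open_O by blast
  qed
  show ?thesis
    unfolding Hausdorff_space_def topspace_O
  proof (intro allI impI, elim conjE)
    fix A B :: "'a ranger set"
    assume "A \<in> blocks" "B \<in> blocks" "A \<noteq> B"
    then obtain x y where xy: "A = cls x" "B = cls y" by (elim blocks_cases) blast
    then consider "separated x y" | "separated y x" using \<open>A \<noteq> B\<close> by (auto simp: class_eq_iff)
    then show "\<exists>U V. openin ?O U \<and> openin ?O V \<and> A \<in> U \<and> B \<in> V \<and> disjnt U V"
    proof cases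
      case 1
      then show ?thesis using sep unfolding xy by blast
    next
      case 2
      then show ?thesis using sep[of y x] unfolding xy by (metis disjnt_sym)
    qed
  qed
qed

section \<open>The quotient topology on the blocks\<close>

lemma quotient_map_blocks:
  "quotient_map ranger_topology (quotient_topology ranger_topology closure_identification) cls"
  using quotient_map_quotient_topology[of ranger_topology] equiv_closure_identification by simp

lemma topspace_quotient_blocks:
  "topspace (quotient_topology ranger_topology closure_identification) = blocks"
  by (simp add: equiv_closure_identification)

lemma compact_space_quotient_blocks:
  "compact_space (quotient_topology ranger_topology closure_identification)"
  using image_compactin[OF _ quotient_imp_continuous_map[OF quotient_map_blocks]]
    compact_space_ranger_topology quotient_imp_surjective_map[OF quotient_map_blocks]
  unfolding compact_space_def by metis

text \<open>The identity from the quotient topology to the order topology is a continuous bijection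
  from a compact space to a Hausdorff space.\<close>

lemma quotient_topology_eq_order_topology:
  "quotient_topology ranger_topology closure_identification =
    order_topology_on (blocks :: 'a::linordered_ab_group_add ranger set set) (quotient_order blocks)"
  (is "?Q = ?O")
proof -
  have E: "equiv (topspace (ranger_topology :: 'a ranger topology)) closure_identification"
    using equiv_closure_identification by simp
  \<comment> \<open>For a property invariant under the identification, the blocks meeting it cover
    exactly the points that have it; openness in the quotient then reduces to openness of a set of
    rangers.\<close>
  have Union_eq: "\<Union> {A \<in> blocks. \<exists>y\<in>A. P y} = {y. P y}"
    if P: "\<And>x y. (x, y) \<in> closure_identification \<Longrightarrow> P x \<Longrightarrow> P y"
    for P :: "'a ranger \<Rightarrow> bool"
  proof (intro equalityI subsetI)
    fix z assume "z \<in> \<Union> {A \<in> blocks. \<exists>y\<in>A. P y}"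
    then obtain A y where "A \<in> blocks" "y \<in> A" "P y" "z \<in> A" by blast
    then show "z \<in> {y. P y}"
      using P[of y z] quotient_eq_iff[OF equiv_closure_identification, of A A y z] by blast
  next
    fix z assume "z \<in> {y. P y}"
    then show "z \<in> \<Union> {A \<in> blocks. \<exists>y\<in>A. P y}"
      using equiv_class_self[OF equiv_closure_identification, of z]
        quotientI[of z UNIV closure_identification] by blast
  qed
  have right: "openin ?Q {A \<in> blocks. \<exists>y\<in>A. separated x y}" for x :: "'a ranger"
  proof -
    have "\<Union> {A \<in> blocks. \<exists>y\<in>A. separated x y} = {y. separated x y}"
      by (rule Union_eq) (use separated_cotrans in \<open>auto simp: closure_identification_eq\<close>)
    then show ?thesis
      unfolding openin_quotient_topology[OF E] using openin_separated_right by auto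
  qed
  have left: "openin ?Q {A \<in> blocks. \<exists>y\<in>A. separated y x}" for x :: "'a ranger"
  proof -
    have "\<Union> {A \<in> blocks. \<exists>y\<in>A. separated y x} = {y. separated y x}"
      by (rule Union_eq) (use separated_cotrans in \<open>auto simp: closure_identification_eq\<close>)
    then show ?thesis
      unfolding openin_quotient_topology[OF E] using openin_separated_left by auto
  qed
  have all: "openin ?Q blocks"
    using openin_topspace[of ?Q] by (simp add: topspace_quotient_blocks)
  have "continuous_map ?Q ?O id"
    unfolding order_topology_on_blocks
  proof (rule continuous_on_generated_topo)
    fix U :: "'a ranger set set"
    assume "U \<in> {blocks} \<union> range (\<lambda>x. {A \<in> blocks. \<exists>y\<in>A. separated x y})
       \<union> range (\<lambda>x. {A \<in> blocks. \<exists>y\<in>A. separated y x})"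
    then have "openin ?Q U" using all left right by blast
    then show "openin ?Q (id -` U \<inter> topspace ?Q)" by (simp add: openin_Int)
  qed (simp add: topspace_quotient_blocks)
  moreover have "id ` topspace ?Q = topspace ?O"
    unfolding order_topology_on_blocks topspace_quotient_blocks by auto
  \<comment> \<open>That the identity is a homeomorphism means equality of the topologies.\<close>
  ultimately have "homeomorphic_map ?Q ?O id"
    by (intro continuous_imp_homeomorphic_map compact_space_quotient_blocks
        Hausdorff_order_topology_on_blocks) auto
  then show ?thesis by simp
qed

text \<open>The quotient by \<open>closure_identification\<close> carries a Hausdorff order
  topology, so this relation takes part in the intersection; the other inclusion is the collapse of
  closures.\<close>

lemma max_hausdorff_rel_ranger_topology:
  "max_hausdorff_rel ranger_topology = closure_identification"
proof
  show "max_hausdorff_rel (ranger_topology :: 'a::linordered_ab_group_add ranger topology) \<subseteq> closure_identification"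
    unfolding max_hausdorff_rel_def
    using equiv_closure_identification Hausdorff_order_topology_on_blocks
    by (intro Inter_lower) (simp add: quotient_topology_eq_order_topology)
qed (rule closure_identification_subset_max_hausdorff_rel)

end

section \<open>Assembly of the three statements\<close>

theorem theorem2p1p18:
  fixes R :: "'a::linordered_ab_group_add ranger topology"
    and Rh :: "'a ranger set topology"
  assumes R: "R = ranger_topology"
    and Rh: "Rh = max_hausdorff_quotient R"
  shows
    "(compact_space R \<and> connected_space R \<and>
      (\<forall>x. \<not> is_unbounded x \<longrightarrow>
        (\<exists>A B. A \<noteq> B \<and> A \<inter> B = {} \<and> A \<union> B = UNIV - {x} \<and>
          connected_components_of (subtopology R (UNIV - {x})) = {A, B})))
     \<and>
     ((\<forall>q. R closure_of {divisorial q} = {divisorial q, succ_ranger q, pred_ranger q} \<and>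
          {minus_infinity..pred_ranger q} = {minus_infinity..<divisorial q} \<and>
          closedin R {minus_infinity..<divisorial q} \<and>
          {succ_ranger q..plus_infinity} = {divisorial q<..plus_infinity} \<and>
          closedin R {divisorial q<..plus_infinity}) \<and>
      (\<forall>y. \<not> is_divisorial y \<longrightarrow>
          openin R {minus_infinity..<y} \<and> openin R {y<..plus_infinity} \<and> closedin R {y}))
     \<and>
     (Rh = quotient_topology R closure_identification \<and>
      linear_order_on (topspace Rh) (quotient_order (topspace Rh)) \<and>
      Rh = order_topology_on (topspace Rh) (quotient_order (topspace Rh)) \<and>
      compact_space Rh \<and> Hausdorff_space Rh \<and> connected_space Rh)"
proof -
  have Rh_Q: "Rh = quotient_topology ranger_topology closure_identification"
    unfolding Rh R max_hausdorff_quotient_def max_hausdorff_rel_ranger_topology ..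
  have blocks: "topspace Rh = UNIV // closure_identification"
    unfolding Rh_Q by (rule topspace_quotient_blocks)
  \<comment> \<open>Intervals with an extreme endpoint are rays, the form in which the topological
    facts were proved.\<close>
  have lo: "{minus_infinity..<y} = {..<y}" and gr: "{y<..plus_infinity} = {y<..}"
    and le: "{minus_infinity..y} = {..y}" and ge: "{y..plus_infinity} = {y..}"
    for y :: "'a ranger"
    by auto
  have conn: "connected_space (ranger_topology :: 'a ranger topology)"
    using connectedin_convex[of "UNIV :: 'a ranger set"]
      connectedin_topspace[of "ranger_topology :: 'a ranger topology"]
    by simp
  have i: "\<exists>A B. A \<noteq> B \<and> A \<inter> B = {} \<and> A \<union> B = UNIV - {x} \<and>
      connected_components_of (subtopology R (UNIV - {x})) = {A, B}"
    if "\<not> is_unbounded x" for x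
  proof (intro exI conjI)
    show "connected_components_of (subtopology R (UNIV - {x})) = {{..<x}, {x<..}}"
      unfolding R by (rule connected_components_of_punctured[OF that])
    \<comment> \<open>Boundedness of \<open>x\<close> puts \<open>minus_infinity\<close> into the
      lower ray only, so the two components differ.\<close>
    have "minus_infinity \<in> {..<x}"
      using that unfolding is_unbounded_def by (metis lessThan_iff minus_infinity_le order_le_less)
    moreover have "minus_infinity \<notin> {x<..}"
      by (simp add: leD)
    ultimately show "{..<x} \<noteq> {x<..}" by blast
  qed auto
  have ii: "{minus_infinity..pred_ranger q} = {minus_infinity..<divisorial q}"
    "{succ_ranger q..plus_infinity} = {divisorial q<..plus_infinity}" for q :: "'a divisible_hull"
    unfolding lo gr le ge by (simp_all add: set_eq_iff le_pred_ranger_iff succ_ranger_le_iff)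
  have "linear_order_on (topspace Rh) (quotient_order (topspace Rh))"
    unfolding blocks by (rule linear_order_on_blocks)
  moreover have "Rh = order_topology_on (topspace Rh) (quotient_order (topspace Rh))"
    unfolding blocks unfolding Rh_Q by (rule quotient_topology_eq_order_topology)
  moreover have "compact_space Rh" "connected_space Rh"
    unfolding Rh_Q
    using compact_space_quotient_blocks connected_space_quotient_map_image[OF quotient_map_blocks conn]
    by blast+
  moreover have "Hausdorff_space Rh"
    unfolding Rh by (rule Hausdorff_max_hausdorff_quotient)
  moreover have "Rh = quotient_topology R closure_identification"
    unfolding R by (rule Rh_Q)
  moreover have "R closure_of {divisorial q} = {divisorial q, succ_ranger q, pred_ranger q}" for q
    unfolding R by (rule closure_of_divisorial)
  moreover have "closedin R {minus_infinity..<divisorial q}" "closedin R {divisorial q<..plus_infinity}" for q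
    unfolding R lo gr by (rule closedin_lessThan_divisorial closedin_greaterThan_divisorial)+
  moreover have "openin R {minus_infinity..<y}" "openin R {y<..plus_infinity}" "closedin R {y}"
    if "\<not> is_divisorial y" for y
    unfolding R lo gr
    using that by (rule openin_lessThan openin_greaterThan closedin_singleton)+
  moreover have "compact_space R" "connected_space R"
    unfolding R by (rule compact_space_ranger_topology conn)+
  ultimately show ?thesis
    using i ii by (intro conjI allI impI)
qed

end
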